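(* Let $(M,\varphi,\eta,\xi,g)$ be a quasi-para-Sasakian manifold of constant $\varphi$-para-holomorphic sectional curvature $H=-1$. Then $M$ is a space of constant curvature.
   Context: An almost paracontact metric manifold $(M,\varphi,\eta,\xi,g)$ is a smooth manifold $M$ of dimension $2n+1$ ($n\ge 1$) with a $(1,1)$-tensor field $\varphi$, a vector field $\xi$, a 1-form $\eta$ and a pseudo-Riemannian metric $g$ such that $\varphi\xi=0$, $\eta\circ\varphi=0$, $\eta(\xi)=1$, $\varphi^2=\mathrm{id}-\eta\otimes\xi$, $\varphi$ induces an almost paracomplex structure on each fibre of $\mathbb D=\ker\eta$, and $g(\varphi X,\varphi Y)=-g(X,Y)+\eta(X)\eta(Y)$ for all $X,Y$ (hence $\eta(X)=g(X,\xi)$ and $g$ has signature $(n+1,n)$). It is quasi-para-Sasakian if $(\nabla_X\varphi)Y=g(X,Y)\xi-\eta(Y)X$ for all vector fields $X,Y$, where $\nabla$ is the Levi-Civita connection of $g$. The curvature tensor is $R(X,Y)Z=\nabla_X\nabla_YZ-\nabla_Y\nabla_XZ-\nabla_{[X,Y]}Z$, and $R(X,Y,Z,W)=g(R(X,Y)Z,W)$. For $X\in\mathbb D_p$ with $g(X,X)=\pm1$ (so $g(\varphi X,\varphi X)=-g(X,X)$), the $\varphi$-para-holomorphic sectional curvature is $K(X,\varphi X)=-R(X,\varphi X,\varphi X,X)$. $M$ has constant $\varphi$-para-holomorphic sectional curvature $H\in\mathbb R$ if $K(X,\varphi X)=H$ for all $p\in M$ and all such $X$. Constant curvature $c$ means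 $R(X,Y)Z=c\,(g(Y,Z)X-g(X,Z)Y)$ for all $X,Y,Z$, with $c$ a constant. *)

theory Defs
  imports "HOL-Analysis.Analysis" "HOL-Library.Function_Algebras"
begin

section \<open>Functions as a real vector space\<close>

text \<open>
  Tangent vectors are functionals on functions, so the pointwise vector space structure on
  function types makes the library's \<open>dim\<close>, sums and scalar multiples available for them.
\<close>

instantiation "fun" :: (type, scaleR) scaleR
begin

definition scaleR_fun :: "real \<Rightarrow> ('a \<Rightarrow> 'b) \<Rightarrow> 'a \<Rightarrow> 'b"
  where "scaleR_fun c f = (\<lambda>x. c *\<^sub>R f x)"

instance ..

end

instance "fun" :: (type, real_vector) real_vector
  by standard (auto simp: scaleR_fun_def fun_eq_iff scaleR_add_right scaleR_add_left)


section \<open>Smooth manifolds\<close>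

text \<open>
  \<open>Ck_on k S f\<close> is meant for open \<open>S\<close> in a Euclidean space: iterated directional
  derivatives up to order \<open>k\<close> exist and are continuous on \<open>S\<close>.
\<close>

primrec Ck_on :: "nat \<Rightarrow> 'a::real_normed_vector set \<Rightarrow> ('a \<Rightarrow> 'b::real_normed_vector) \<Rightarrow> bool" where
  "Ck_on 0 S f \<longleftrightarrow> continuous_on S f"
| "Ck_on (Suc k) S f \<longleftrightarrow>
     (\<forall>x\<in>S. f differentiable (at x)) \<and> (\<forall>v. Ck_on k S (\<lambda>x. frechet_derivative f (at x) v))"

definition Cinf_on :: "'a::real_normed_vector set \<Rightarrow> ('a \<Rightarrow> 'b::real_normed_vector) \<Rightarrow> bool" where
  "Cinf_on S f \<longleftrightarrow> (\<forall>k. Ck_on k S f)"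

type_synonym ('m, 'e) atlas = "('m set \<times> ('m \<Rightarrow> 'e)) set"

text \<open>
  The manifold is the whole type \<open>'m\<close>; the Hausdorff property and second countability are
  carried by its type classes, and its dimension is \<open>DIM('e)\<close>.  The atlas need not be maximal.
\<close>

definition smooth_manifold ::
  "('m::{t2_space, second_countable_topology}, 'e::euclidean_space) atlas \<Rightarrow> bool" where
  "smooth_manifold A \<longleftrightarrow>
     (\<forall>(U, \<psi>)\<in>A. open U \<and> open (\<psi> ` U) \<and> (\<exists>\<psi>'. homeomorphism U (\<psi> ` U) \<psi> \<psi>')) \<and>
     (\<Union>(U, \<psi>)\<in>A. U) = UNIV \<and>
     (\<forall>(U, \<psi>)\<in>A. \<forall>(V, \<theta>)\<in>A. Cinf_on (\<psi> ` (U \<inter> V)) (\<theta> \<circ> inv_into U \<psi>))"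

definition smooth_fun ::
  "('m::{t2_space, second_countable_topology}, 'e::euclidean_space) atlas \<Rightarrow> ('m \<Rightarrow> real) \<Rightarrow> bool" where
  "smooth_fun A f \<longleftrightarrow> (\<forall>(U, \<psi>)\<in>A. Cinf_on (\<psi> ` U) (f \<circ> inv_into U \<psi>))"


section \<open>Tangent vectors, vector fields and tensor fields\<close>

type_synonym 'm tvec = "('m \<Rightarrow> real) \<Rightarrow> real"
type_synonym 'm vfield = "'m \<Rightarrow> 'm tvec"

text \<open>
  The tangent space at \<open>p\<close> consists of the derivations at \<open>p\<close> of the algebra of smooth
  functions.  As functions are total, a derivation is fixed to be \<open>0\<close> on non-smooth arguments,
  so that equality of tangent vectors is equality of derivations.
\<close>

definition tangent_space ::
  "('m::{t2_space, second_countable_topology}, 'e::euclidean_space) atlas \<Rightarrow> 'm \<Rightarrow> 'm tvec set" where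
  "tangent_space A p = {v.
     (\<forall>f g. smooth_fun A f \<longrightarrow> smooth_fun A g \<longrightarrow> v (\<lambda>q. f q + g q) = v f + v g) \<and>
     (\<forall>c f. smooth_fun A f \<longrightarrow> v (\<lambda>q. c * f q) = c * v f) \<and>
     (\<forall>f g. smooth_fun A f \<longrightarrow> smooth_fun A g \<longrightarrow>
        v (\<lambda>q. f q * g q) = f p * v g + g p * v f) \<and>
     (\<forall>f. \<not> smooth_fun A f \<longrightarrow> v f = 0)}"

definition vector_field ::
  "('m::{t2_space, second_countable_topology}, 'e::euclidean_space) atlas \<Rightarrow> 'm vfield \<Rightarrow> bool" where
  "vector_field A X \<longleftrightarrow>
     (\<forall>p. X p \<in> tangent_space A p) \<and> (\<forall>f. smooth_fun A f \<longrightarrow> smooth_fun A (\<lambda>p. X p f))"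

definition lie_bracket :: "'m vfield \<Rightarrow> 'm vfield \<Rightarrow> 'm vfield" where
  "lie_bracket X Y = (\<lambda>p f. X p (\<lambda>q. Y q f) - Y p (\<lambda>q. X q f))"

definition one_form ::
  "('m::{t2_space, second_countable_topology}, 'e::euclidean_space) atlas \<Rightarrow>
   ('m \<Rightarrow> 'm tvec \<Rightarrow> real) \<Rightarrow> bool" where
  "one_form A \<eta> \<longleftrightarrow>
     (\<forall>p. \<forall>x\<in>tangent_space A p. \<forall>y\<in>tangent_space A p. \<forall>c.
        \<eta> p (x + y) = \<eta> p x + \<eta> p y \<and> \<eta> p (c *\<^sub>R x) = c * \<eta> p x) \<and>
     (\<forall>X. vector_field A X \<longrightarrow> smooth_fun A (\<lambda>p. \<eta> p (X p)))"

definition tensor_field_1_1 ::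
  "('m::{t2_space, second_countable_topology}, 'e::euclidean_space) atlas \<Rightarrow>
   ('m \<Rightarrow> 'm tvec \<Rightarrow> 'm tvec) \<Rightarrow> bool" where
  "tensor_field_1_1 A \<phi> \<longleftrightarrow>
     (\<forall>p. \<forall>x\<in>tangent_space A p. \<phi> p x \<in> tangent_space A p) \<and>
     (\<forall>p. \<forall>x\<in>tangent_space A p. \<forall>y\<in>tangent_space A p. \<forall>c.
        \<phi> p (x + y) = \<phi> p x + \<phi> p y \<and> \<phi> p (c *\<^sub>R x) = c *\<^sub>R \<phi> p x) \<and>
     (\<forall>X. vector_field A X \<longrightarrow> vector_field A (\<lambda>p. \<phi> p (X p)))"

definition pseudo_riemannian_metric ::
  "('m::{t2_space, second_countable_topology}, 'e::euclidean_space) atlas \<Rightarrow>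
   ('m \<Rightarrow> 'm tvec \<Rightarrow> 'm tvec \<Rightarrow> real) \<Rightarrow> bool" where
  "pseudo_riemannian_metric A g \<longleftrightarrow>
     (\<forall>p. \<forall>x\<in>tangent_space A p. \<forall>y\<in>tangent_space A p. \<forall>z\<in>tangent_space A p. \<forall>c.
        g p (x + y) z = g p x z + g p y z \<and> g p (c *\<^sub>R x) z = c * g p x z) \<and>
     (\<forall>p. \<forall>x\<in>tangent_space A p. \<forall>y\<in>tangent_space A p. g p x y = g p y x) \<and>
     (\<forall>p. \<forall>x\<in>tangent_space A p. (\<forall>y\<in>tangent_space A p. g p x y = 0) \<longrightarrow> x = 0) \<and>
     (\<forall>X Y. vector_field A X \<longrightarrow> vector_field A Y \<longrightarrow> smooth_fun A (\<lambda>p. g p (X p) (Y p)))"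


section \<open>Levi-Civita connection and curvature\<close>

definition affine_connection ::
  "('m::{t2_space, second_countable_topology}, 'e::euclidean_space) atlas \<Rightarrow>
   ('m vfield \<Rightarrow> 'm vfield \<Rightarrow> 'm vfield) \<Rightarrow> bool" where
  "affine_connection A nabla \<longleftrightarrow>
     (\<forall>X Y. vector_field A X \<longrightarrow> vector_field A Y \<longrightarrow> vector_field A (nabla X Y)) \<and>
     (\<forall>X Y Z. vector_field A X \<longrightarrow> vector_field A Y \<longrightarrow> vector_field A Z \<longrightarrow>
        nabla (X + Y) Z = nabla X Z + nabla Y Z \<and> nabla X (Y + Z) = nabla X Y + nabla X Z) \<and>
     (\<forall>f X Y. smooth_fun A f \<longrightarrow> vector_field A X \<longrightarrow> vector_field A Y \<longrightarrow>
        nabla (\<lambda>p. f p *\<^sub>R X p) Y = (\<lambda>p. f p *\<^sub>R nabla X Y p) \<and>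
        nabla X (\<lambda>p. f p *\<^sub>R Y p) = (\<lambda>p. X p f *\<^sub>R Y p + f p *\<^sub>R nabla X Y p))"

definition levi_civita ::
  "('m::{t2_space, second_countable_topology}, 'e::euclidean_space) atlas \<Rightarrow>
   ('m \<Rightarrow> 'm tvec \<Rightarrow> 'm tvec \<Rightarrow> real) \<Rightarrow> ('m vfield \<Rightarrow> 'm vfield \<Rightarrow> 'm vfield) \<Rightarrow> bool" where
  "levi_civita A g nabla \<longleftrightarrow>
     affine_connection A nabla \<and>
     (\<forall>X Y. vector_field A X \<longrightarrow> vector_field A Y \<longrightarrow>
        nabla X Y - nabla Y X = lie_bracket X Y) \<and>
     (\<forall>X Y Z. vector_field A X \<longrightarrow> vector_field A Y \<longrightarrow> vector_field A Z \<longrightarrow>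
        (\<forall>p. X p (\<lambda>q. g q (Y q) (Z q)) = g p (nabla X Y p) (Z p) + g p (Y p) (nabla X Z p)))"

definition curvature ::
  "('m vfield \<Rightarrow> 'm vfield \<Rightarrow> 'm vfield) \<Rightarrow> 'm vfield \<Rightarrow> 'm vfield \<Rightarrow> 'm vfield \<Rightarrow> 'm vfield" where
  "curvature nabla X Y Z =
     nabla X (nabla Y Z) - nabla Y (nabla X Z) - nabla (lie_bracket X Y) Z"

text \<open>
  The value of the curvature tensor on tangent vectors \<open>x\<close>, \<open>y\<close>, \<open>z\<close> at \<open>p\<close>: the common value
  at \<open>p\<close> for all smooth vector fields extending them.
\<close>

definition curvature_at ::
  "('m::{t2_space, second_countable_topology}, 'e::euclidean_space) atlas \<Rightarrow>
   ('m vfield \<Rightarrow> 'm vfield \<Rightarrow> 'm vfield) \<Rightarrow> 'm \<Rightarrow> 'm tvec \<Rightarrow> 'm tvec \<Rightarrow> 'm tvec \<Rightarrow> 'm tvec" where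
  "curvature_at A nabla p x y z = (THE v. \<forall>X Y Z.
     vector_field A X \<longrightarrow> vector_field A Y \<longrightarrow> vector_field A Z \<longrightarrow>
     X p = x \<longrightarrow> Y p = y \<longrightarrow> Z p = z \<longrightarrow> curvature nabla X Y Z p = v)"

definition constant_curvature ::
  "('m::{t2_space, second_countable_topology}, 'e::euclidean_space) atlas \<Rightarrow>
   ('m \<Rightarrow> 'm tvec \<Rightarrow> 'm tvec \<Rightarrow> real) \<Rightarrow> ('m vfield \<Rightarrow> 'm vfield \<Rightarrow> 'm vfield) \<Rightarrow> real \<Rightarrow> bool" where
  "constant_curvature A g nabla c \<longleftrightarrow>
     (\<forall>X Y Z. vector_field A X \<longrightarrow> vector_field A Y \<longrightarrow> vector_field A Z \<longrightarrow>
        curvature nabla X Y Z =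
          (\<lambda>p. c *\<^sub>R (g p (Y p) (Z p) *\<^sub>R X p - g p (X p) (Z p) *\<^sub>R Y p)))"


section \<open>Quasi-para-Sasakian manifolds\<close>

definition contact_distribution ::
  "('m::{t2_space, second_countable_topology}, 'e::euclidean_space) atlas \<Rightarrow>
   ('m \<Rightarrow> 'm tvec \<Rightarrow> real) \<Rightarrow> 'm \<Rightarrow> 'm tvec set" where
  "contact_distribution A \<eta> p = {x \<in> tangent_space A p. \<eta> p x = 0}"

text \<open>A paracomplex structure: an involution whose two eigenspaces have the same dimension.\<close>

definition paracomplex_structure_on :: "'v::real_vector set \<Rightarrow> ('v \<Rightarrow> 'v) \<Rightarrow> bool" where
  "paracomplex_structure_on V J \<longleftrightarrow>
     (\<forall>x\<in>V. J x \<in> V) \<and>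
     (\<forall>x\<in>V. \<forall>y\<in>V. \<forall>c. J (x + y) = J x + J y \<and> J (c *\<^sub>R x) = c *\<^sub>R J x) \<and>
     (\<forall>x\<in>V. J (J x) = x) \<and>
     dim {x\<in>V. J x = x} = dim {x\<in>V. J x = - x}"

definition almost_paracontact_metric_manifold ::
  "('m::{t2_space, second_countable_topology}, 'e::euclidean_space) atlas \<Rightarrow>
   ('m \<Rightarrow> 'm tvec \<Rightarrow> 'm tvec) \<Rightarrow> ('m \<Rightarrow> 'm tvec \<Rightarrow> real) \<Rightarrow> 'm vfield \<Rightarrow>
   ('m \<Rightarrow> 'm tvec \<Rightarrow> 'm tvec \<Rightarrow> real) \<Rightarrow> bool" where
  "almost_paracontact_metric_manifold A \<phi> \<eta> \<xi> g \<longleftrightarrow>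
     smooth_manifold A \<and>
     (\<exists>n\<ge>1. DIM('e) = 2 * n + 1) \<and>
     tensor_field_1_1 A \<phi> \<and> one_form A \<eta> \<and> vector_field A \<xi> \<and> pseudo_riemannian_metric A g \<and>
     (\<forall>p. \<phi> p (\<xi> p) = 0 \<and> \<eta> p (\<xi> p) = 1) \<and>
     (\<forall>p. \<forall>x\<in>tangent_space A p.
        \<eta> p (\<phi> p x) = 0 \<and> \<phi> p (\<phi> p x) = x - \<eta> p x *\<^sub>R \<xi> p) \<and>
     (\<forall>p. paracomplex_structure_on (contact_distribution A \<eta> p) (\<phi> p)) \<and>
     (\<forall>p. \<forall>x\<in>tangent_space A p. \<forall>y\<in>tangent_space A p.
        g p (\<phi> p x) (\<phi> p y) = - g p x y + \<eta> p x * \<eta> p y)"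

text \<open>The last condition is \<open>(\<nabla>\<^sub>X \<phi>) Y = g(X, Y) \<xi> - \<eta>(Y) X\<close>.\<close>

definition quasi_para_sasakian ::
  "('m::{t2_space, second_countable_topology}, 'e::euclidean_space) atlas \<Rightarrow>
   ('m \<Rightarrow> 'm tvec \<Rightarrow> 'm tvec) \<Rightarrow> ('m \<Rightarrow> 'm tvec \<Rightarrow> real) \<Rightarrow> 'm vfield \<Rightarrow>
   ('m \<Rightarrow> 'm tvec \<Rightarrow> 'm tvec \<Rightarrow> real) \<Rightarrow> ('m vfield \<Rightarrow> 'm vfield \<Rightarrow> 'm vfield) \<Rightarrow> bool" where
  "quasi_para_sasakian A \<phi> \<eta> \<xi> g nabla \<longleftrightarrow>
     almost_paracontact_metric_manifold A \<phi> \<eta> \<xi> g \<and>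
     levi_civita A g nabla \<and>
     (\<forall>X Y. vector_field A X \<longrightarrow> vector_field A Y \<longrightarrow>
        (\<forall>p. nabla X (\<lambda>q. \<phi> q (Y q)) p - \<phi> p (nabla X Y p) =
             g p (X p) (Y p) *\<^sub>R \<xi> p - \<eta> p (Y p) *\<^sub>R X p))"

definition phi_sectional_curvature ::
  "('m::{t2_space, second_countable_topology}, 'e::euclidean_space) atlas \<Rightarrow>
   ('m \<Rightarrow> 'm tvec \<Rightarrow> 'm tvec) \<Rightarrow> ('m \<Rightarrow> 'm tvec \<Rightarrow> 'm tvec \<Rightarrow> real) \<Rightarrow>
   ('m vfield \<Rightarrow> 'm vfield \<Rightarrow> 'm vfield) \<Rightarrow> 'm \<Rightarrow> 'm tvec \<Rightarrow> real" where
  "phi_sectional_curvature A \<phi> g nabla p x =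
     - g p (curvature_at A nabla p x (\<phi> p x) (\<phi> p x)) x"

definition constant_phi_sectional_curvature ::
  "('m::{t2_space, second_countable_topology}, 'e::euclidean_space) atlas \<Rightarrow>
   ('m \<Rightarrow> 'm tvec \<Rightarrow> 'm tvec) \<Rightarrow> ('m \<Rightarrow> 'm tvec \<Rightarrow> real) \<Rightarrow>
   ('m \<Rightarrow> 'm tvec \<Rightarrow> 'm tvec \<Rightarrow> real) \<Rightarrow> ('m vfield \<Rightarrow> 'm vfield \<Rightarrow> 'm vfield) \<Rightarrow> real \<Rightarrow> bool" where
  "constant_phi_sectional_curvature A \<phi> \<eta> g nabla H \<longleftrightarrow>
     (\<forall>p. \<forall>x\<in>contact_distribution A \<eta> p. g p x x = 1 \<or> g p x x = - 1 \<longrightarrow>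
        phi_sectional_curvature A \<phi> g nabla p x = H)"

end

theory Submission
  imports Defs
begin

text \<open>
  Since \<open>\<nabla>\<^sub>X \<xi> = \<phi> X\<close>, the curvature tensor \<open>R\<close> satisfies \<open>R(X, Y) \<xi> = \<eta>(X) Y - \<eta>(Y) X\<close>, and its failure to
  commute with \<open>\<phi>\<close> is exactly that of the model tensor of constant curvature \<open>-1\<close>.  Hence the
  difference \<open>S\<close> of the two is an algebraic curvature tensor that kills \<open>\<xi>\<close> and commutes with \<open>\<phi>\<close>,
  so that on \<open>ker \<eta>\<close> only its components \<open>S(a, b, c, d)\<close> with \<open>a, c\<close> in the \<open>+1\<close>-eigenspace and
  \<open>b, d\<close> in the \<open>-1\<close>-eigenspace of \<open>\<phi>\<close> can be nonzero, up to symmetries.  The hypothesis \<open>H = -1\<close>, applied to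
  \<open>a + b\<close>, gives \<open>S(a, b, a, b) = 0\<close>, and polarisation gives \<open>S = 0\<close>.

  The pointwise meaning of the curvature tensor rests on the fact that every derivation extends to a
  vector field and that tensorial operators vanish where their argument does; both follow from a
  cut-off coordinate frame, obtained from Hadamard's lemma.
\<close>

section \<open>Calculus of \<open>C\<^sup>k\<close> functions\<close>

lemma frechet_derivative_eq:
  "(f has_derivative f') (at x) \<Longrightarrow> frechet_derivative f (at x) = f'"
  by (metis frechet_derivative_at)

text \<open>A derivative only sees a neighbourhood of its point, so on an open set agreement passes
  on to the derivatives and the induction goes through.\<close>

lemma Ck_on_cong:
  assumes "open S" "Ck_on k S f" "\<And>x. x \<in> S \<Longrightarrow> f x = g x"
  shows "Ck_on k S g"
  using assms(2,3)
proof (induction k arbitrary: f g)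
  case 0
  then show ?case using continuous_on_cong[of S S f g] by simp
next
  case (Suc k)
  have d: "(f has_derivative frechet_derivative f (at x)) (at x)" if "x \<in> S" for x
    using Suc.prems(1) that frechet_derivative_works by auto
  have d': "(g has_derivative frechet_derivative f (at x)) (at x)" if "x \<in> S" for x
    by (rule has_derivative_transform_within_open[OF d[OF that] assms(1) that Suc.prems(2)])
  have "Ck_on k S (\<lambda>x. frechet_derivative g (at x) v)" for v
    by (rule Suc.IH[where f="\<lambda>x. frechet_derivative f (at x) v"])
      (use Suc.prems(1) in \<open>simp_all add: frechet_derivative_eq[OF d']\<close>)
  then show ?case
    using d' by (auto simp: differentiable_def)
qed

text \<open>\<open>Ck_on\<close> refers to \<open>frechet_derivative\<close>; this rule lets any
  explicit formula for the derivative take its place, and most closure properties below go through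
  it.\<close>

lemma Ck_on_SucI:
  assumes "open S" "\<And>x. x \<in> S \<Longrightarrow> (f has_derivative f' x) (at x)"
    and "\<And>v. Ck_on k S (\<lambda>x. f' x v)"
  shows "Ck_on (Suc k) S f"
proof -
  have "Ck_on k S (\<lambda>x. frechet_derivative f (at x) v)" for v
    by (rule Ck_on_cong[OF assms(1) assms(3)[of v]]) (simp add: frechet_derivative_eq[OF assms(2)])
  then show ?thesis
    using assms(2) by (auto simp: differentiable_def)
qed

lemma Ck_on_Suc_has_derivative:
  "Ck_on (Suc k) S f \<Longrightarrow> x \<in> S \<Longrightarrow> (f has_derivative frechet_derivative f (at x)) (at x)"
  using frechet_derivative_works by auto

lemma Ck_on_Suc_lower: "Ck_on (Suc k) S f \<Longrightarrow> Ck_on k S f"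
proof (induction k arbitrary: f)
  case 0
  then show ?case
    by (auto intro!: continuous_at_imp_continuous_on differentiable_imp_continuous_within)
next
  case (Suc k)
  then show ?case by (metis Ck_on.simps(2))
qed

lemma Ck_on_imp_continuous_on: "Ck_on k S f \<Longrightarrow> continuous_on S f"
  by (induction k) (auto dest: Ck_on_Suc_lower simp del: Ck_on.simps(2))

lemma Ck_on_subset: "Ck_on k S f \<Longrightarrow> T \<subseteq> S \<Longrightarrow> Ck_on k T f"
  by (induction k arbitrary: f) (auto intro: continuous_on_subset)

lemma Ck_on_Un:
  assumes "open S" "open T"
  shows "Ck_on k S f \<Longrightarrow> Ck_on k T f \<Longrightarrow> Ck_on k (S \<union> T) f"
  by (induction k arbitrary: f) (auto intro: continuous_on_open_Un assms)

lemma Ck_on_const: "open S \<Longrightarrow> Ck_on k S (\<lambda>x. c)"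
proof (induction k arbitrary: c)
  case (Suc k)
  then show ?case
    by (intro Ck_on_SucI[where f'="\<lambda>x v. 0"]) auto
qed simp

lemma Ck_on_bounded_linear:
  assumes "bounded_linear L" "open S" "Ck_on k S f"
  shows "Ck_on k S (\<lambda>x. L (f x))"
  using assms(3)
proof (induction k arbitrary: f)
  case 0
  then show ?case
    using assms(1) by (simp add: linear_continuous_on_compose bounded_linear.continuous_on)
next
  case (Suc k)
  show ?case
    using Suc.IH Suc.prems
    by (intro Ck_on_SucI[OF assms(2), where f'="\<lambda>x v. L (frechet_derivative f (at x) v)"])
      (auto intro: bounded_linear.has_derivative[OF assms(1)] Ck_on_Suc_has_derivative[OF Suc.prems])
qed

lemma Ck_on_add:
  assumes "open S"
  shows "Ck_on k S f \<Longrightarrow> Ck_on k S g \<Longrightarrow> Ck_on k S (\<lambda>x. f x + g x)"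
proof (induction k arbitrary: f g)
  case 0
  then show ?case by (auto intro: continuous_intros)
next
  case (Suc k)
  show ?case
    by (rule Ck_on_SucI[OF assms, where
          f'="\<lambda>x v. frechet_derivative f (at x) v + frechet_derivative g (at x) v"])
      (use Suc Ck_on_Suc_has_derivative[OF Suc.prems(1)] Ck_on_Suc_has_derivative[OF Suc.prems(2)]
        in \<open>auto intro!: derivative_eq_intros\<close>)
qed

lemma Ck_on_sum:
  assumes "open S"
  shows "(\<And>i. i \<in> I \<Longrightarrow> Ck_on k S (f i)) \<Longrightarrow> Ck_on k S (\<lambda>x. \<Sum>i\<in>I. f i x)"
  by (induction I rule: infinite_finite_induct) (auto intro!: Ck_on_add Ck_on_const assms)

lemma Ck_on_mult:
  fixes f g :: "'a::real_normed_vector \<Rightarrow> real"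
  assumes "open S"
  shows "Ck_on k S f \<Longrightarrow> Ck_on k S g \<Longrightarrow> Ck_on k S (\<lambda>x. f x * g x)"
proof (induction k arbitrary: f g)
  case 0
  then show ?case by (auto intro: continuous_intros)
next
  case (Suc k)
  note Df = Ck_on_Suc_has_derivative[OF Suc.prems(1)] and Dg = Ck_on_Suc_has_derivative[OF Suc.prems(2)]
  \<comment> \<open>The product rule leaves one factor undifferentiated, and that factor is needed
    at order \<open>k\<close> only.\<close>
  note low = Ck_on_Suc_lower[OF Suc.prems(1)] Ck_on_Suc_lower[OF Suc.prems(2)]
  show ?case
  proof (rule Ck_on_SucI[OF assms])
    show "((\<lambda>x. f x * g x) has_derivative
      (\<lambda>v. f x * frechet_derivative g (at x) v + frechet_derivative f (at x) v * g x)) (at x)"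
      if "x \<in> S" for x
      by (rule has_derivative_mult[OF Df[OF that] Dg[OF that]])
    show "Ck_on k S (\<lambda>x. f x * frechet_derivative g (at x) v + frechet_derivative f (at x) v * g x)" for v
      using Suc low by (intro Ck_on_add[OF assms] Suc.IH) auto
  qed
qed

text \<open>The chain rule is written out in coordinates: the derivative of the composite becomes a
  finite sum of products of real functions, to which \<open>Ck_on_mult\<close> and the induction
  hypothesis apply.\<close>

lemma Ck_on_compose:
  fixes g :: "'a::real_normed_vector \<Rightarrow> 'e::euclidean_space" and f :: "'e \<Rightarrow> real"
  assumes "open S" "g ` S \<subseteq> T"
  shows "Ck_on k T f \<Longrightarrow> Ck_on k S g \<Longrightarrow> Ck_on k S (\<lambda>x. f (g x))"
proof (induction k arbitrary: f)
  case 0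
  then have "continuous_on T f" "continuous_on S g" by simp_all
  then have "continuous_on S (\<lambda>x. f (g x))"
    by (rule continuous_on_compose2) (rule assms(2))
  then show ?case by simp
next
  case (Suc k)
  let ?f = "\<lambda>y v. frechet_derivative f (at y) v" and ?g = "\<lambda>x v. frechet_derivative g (at x) v"
  note Df = Ck_on_Suc_has_derivative[OF Suc.prems(1)] and Dg = Ck_on_Suc_has_derivative[OF Suc.prems(2)]
  show ?case
  proof (rule Ck_on_SucI[OF assms(1), where f'="\<lambda>x v. \<Sum>b\<in>Basis. (?g x v \<bullet> b) * ?f (g x) b"])
    show "((\<lambda>x. f (g x)) has_derivative (\<lambda>v. \<Sum>b\<in>Basis. (?g x v \<bullet> b) * ?f (g x) b)) (at x)"
      if "x \<in> S" for x
    proof -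
      have D: "(f has_derivative ?f (g x)) (at (g x))"
        using Df assms(2) that by blast
      have eq: "?f (g x) w = (\<Sum>b\<in>Basis. (w \<bullet> b) * ?f (g x) b)" for w
        using Linear_Algebra.linear_componentwise[OF has_derivative_linear[OF D], of w 1] by simp
      show ?thesis
        by (rule has_derivative_eq_rhs[OF has_derivative_compose[OF Dg[OF that] D]]) (rule ext, rule eq)
    qed
    show "Ck_on k S (\<lambda>x. \<Sum>b\<in>Basis. (?g x v \<bullet> b) * ?f (g x) b)" for v
    proof (intro Ck_on_sum Ck_on_mult assms(1))
      fix b :: 'e
      show "Ck_on k S (\<lambda>x. ?g x v \<bullet> b)"
        using Suc.prems(2) by (intro Ck_on_bounded_linear[OF bounded_linear_inner_left] assms(1)) simp
      show "Ck_on k S (\<lambda>x. ?f (g x) b)"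
        using Suc.prems(1) by (intro Suc.IH Ck_on_Suc_lower[OF Suc.prems(2)]) simp
    qed
  qed
qed

lemma Ck_on_id: "open S \<Longrightarrow> Ck_on k S (\<lambda>x. x)"
proof (cases k)
  case (Suc k)
  assume "open S"
  then show ?thesis
    unfolding Suc by (intro Ck_on_SucI[where f'="\<lambda>x v. v"] Ck_on_const) auto
qed simp


section \<open>Closure properties of smooth functions\<close>

lemma Cinf_on_Ck_on: "Cinf_on S f \<Longrightarrow> Ck_on k S f"
  by (simp add: Cinf_on_def)

lemma Cinf_on_cong:
  "open S \<Longrightarrow> Cinf_on S f \<Longrightarrow> (\<And>x. x \<in> S \<Longrightarrow> f x = g x) \<Longrightarrow> Cinf_on S g"
  unfolding Cinf_on_def using Ck_on_cong by blast

lemma Cinf_on_subset: "Cinf_on S f \<Longrightarrow> T \<subseteq> S \<Longrightarrow> Cinf_on T f"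
  unfolding Cinf_on_def using Ck_on_subset by blast

lemma Cinf_on_Un:
  "open S \<Longrightarrow> open T \<Longrightarrow> Cinf_on S f \<Longrightarrow> Cinf_on T f \<Longrightarrow> Cinf_on (S \<union> T) f"
  unfolding Cinf_on_def using Ck_on_Un by blast

lemma Cinf_on_const: "open S \<Longrightarrow> Cinf_on S (\<lambda>x. c)"
  unfolding Cinf_on_def using Ck_on_const by blast

lemma Cinf_on_id: "open S \<Longrightarrow> Cinf_on S (\<lambda>x. x)"
  unfolding Cinf_on_def using Ck_on_id by blast

lemma Cinf_on_bounded_linear:
  "bounded_linear L \<Longrightarrow> open S \<Longrightarrow> Cinf_on S f \<Longrightarrow> Cinf_on S (\<lambda>x. L (f x))"
  unfolding Cinf_on_def using Ck_on_bounded_linear by blast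

lemma Cinf_on_add: "open S \<Longrightarrow> Cinf_on S f \<Longrightarrow> Cinf_on S g \<Longrightarrow> Cinf_on S (\<lambda>x. f x + g x)"
  unfolding Cinf_on_def using Ck_on_add by blast

lemma Cinf_on_sum:
  "open S \<Longrightarrow> (\<And>i. i \<in> I \<Longrightarrow> Cinf_on S (f i)) \<Longrightarrow> Cinf_on S (\<lambda>x. \<Sum>i\<in>I. f i x)"
  unfolding Cinf_on_def using Ck_on_sum[of S I _ f] by blast

lemma Cinf_on_mult:
  fixes f g :: "'a::real_normed_vector \<Rightarrow> real"
  shows "open S \<Longrightarrow> Cinf_on S f \<Longrightarrow> Cinf_on S g \<Longrightarrow> Cinf_on S (\<lambda>x. f x * g x)"
  unfolding Cinf_on_def using Ck_on_mult by blast

lemma Cinf_on_compose: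
  fixes g :: "'a::real_normed_vector \<Rightarrow> 'e::euclidean_space" and f :: "'e \<Rightarrow> real"
  shows "open S \<Longrightarrow> g ` S \<subseteq> T \<Longrightarrow> Cinf_on T f \<Longrightarrow> Cinf_on S g \<Longrightarrow> Cinf_on S (\<lambda>x. f (g x))"
  unfolding Cinf_on_def using Ck_on_compose by blast

lemma Cinf_on_derivative: "Cinf_on S f \<Longrightarrow> Cinf_on S (\<lambda>x. frechet_derivative f (at x) v)"
  unfolding Cinf_on_def by (metis Ck_on.simps(2))

lemma Cinf_on_has_derivative:
  "Cinf_on S f \<Longrightarrow> x \<in> S \<Longrightarrow> (f has_derivative frechet_derivative f (at x)) (at x)"
  using Cinf_on_Ck_on Ck_on_Suc_has_derivative by blast

section \<open>Bump functions and Hadamard's lemma\<close>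

text \<open>The powers of \<open>t\<close> make the family closed under differentiation: the
  derivative of a member is a linear combination of two others, so one induction on the order, with
  \<open>n\<close> arbitrary, proves all of them smooth.\<close>

definition exp_flat :: "nat \<Rightarrow> real \<Rightarrow> real" where
  "exp_flat n t = (if 0 < t then exp (- 1 / t) / t ^ n else 0)"

text \<open>Substituting \<open>t = 1 / x\<close> turns the limit from the right into that of
  \<open>x ^ n / exp x\<close> at infinity.\<close>

lemma exp_flat_tendsto_0: "(exp_flat n \<longlongrightarrow> 0) (at 0)"
proof (rule filterlim_split_at)
  have "\<forall>\<^sub>F t in at_left 0. 0 = exp_flat n t"
    by (auto simp: exp_flat_def eventually_at_filter)
  then show "(exp_flat n \<longlongrightarrow> 0) (at_left 0)"
    by (rule Lim_transform_eventually[OF tendsto_const])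
  have "\<forall>\<^sub>F x in at_top. x ^ n / exp x = exp_flat n (inverse x)"
    using eventually_gt_at_top[of 0]
    by eventually_elim (simp add: exp_flat_def exp_minus field_simps power_inverse)
  then have "((\<lambda>x. exp_flat n (inverse x)) \<longlongrightarrow> 0) at_top"
    by (rule Lim_transform_eventually[OF tendsto_power_div_exp_0])
  then show "(exp_flat n \<longlongrightarrow> 0) (at_right 0)"
    by (simp add: filterlim_at_right_to_top)
qed

lemma exp_flat_has_derivative:
  "(exp_flat n has_real_derivative (exp_flat (n + 2) t - n * exp_flat (n + 1) t)) (at t)"
proof -
  consider "t > 0" | "t < 0" | "t = 0" by linarith
  then show ?thesis
  proof cases
    case 1
    have "((\<lambda>t. exp (- 1 / t) / t ^ n) has_real_derivative
        (exp_flat (n + 2) t - n * exp_flat (n + 1) t)) (at t)"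
      using 1
      apply (auto intro!: derivative_eq_intros simp: exp_flat_def field_simps power2_eq_square)
      apply (cases n; simp add: field_simps)
      done
    then show ?thesis
      by (rule has_field_derivative_transform_within_open[of _ _ _ "{0<..}"])
        (use 1 in \<open>auto simp: exp_flat_def\<close>)
  next
    case 2
    show ?thesis
      by (rule has_field_derivative_transform_within_open[of "\<lambda>_. 0" _ _ "{..<0}"])
        (use 2 in \<open>auto simp: exp_flat_def\<close>)
  next
    case 3
    \<comment> \<open>At \<open>0\<close> the difference quotient merely raises the index by one, so
      the derivative there is a limit already known.\<close>
    have "(\<lambda>h. (exp_flat n (0 + h) - exp_flat n 0) / h) = exp_flat (n + 1)"
      by (auto simp: exp_flat_def)
    then show ?thesis
      using exp_flat_tendsto_0[of "n + 1"] 3 by (simp add: DERIV_def exp_flat_def)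
  qed
qed

lemma Cinf_on_exp_flat: "Cinf_on UNIV (exp_flat n)"
proof -
  have "Ck_on k UNIV (exp_flat n)" for k
  proof (induction k arbitrary: n)
    case 0
    then show ?case
      by (auto intro!: continuous_at_imp_continuous_on DERIV_isCont exp_flat_has_derivative)
  next
    case (Suc k)
    show ?case
    proof (rule Ck_on_SucI)
      show "(exp_flat n has_derivative (*) (exp_flat (n + 2) t - n * exp_flat (n + 1) t)) (at t)" for t
        using exp_flat_has_derivative[of n t] by (simp add: has_field_derivative_def)
      have "Ck_on k UNIV (\<lambda>t. (exp_flat (n + 2) t + (- real n) * exp_flat (n + 1) t) * v)" for v
        by (intro Ck_on_mult Ck_on_add Ck_on_const Suc.IH) auto
      then show "Ck_on k UNIV (\<lambda>t. (exp_flat (n + 2) t - n * exp_flat (n + 1) t) * v)" for v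
        by simp
    qed simp
  qed
  then show ?thesis by (simp add: Cinf_on_def)
qed

lemma smooth_bump_exists:
  fixes x0 :: "'e::euclidean_space"
  assumes "0 < r"
  obtains u :: "'e \<Rightarrow> real"
  where "Cinf_on UNIV u" "u x0 = 1" "\<And>x. x \<notin> ball x0 r \<Longrightarrow> u x = 0"
proof
  \<comment> \<open>This is \<open>r\<^sup>2\<close> minus the squared distance to
    \<open>x0\<close>, kept as a polynomial in the coordinates so that the closure properties give
    smoothness.\<close>
  define q where "q x = r\<^sup>2 + (\<Sum>b\<in>Basis. (- 1) * ((x \<bullet> b + - (x0 \<bullet> b)) * (x \<bullet> b + - (x0 \<bullet> b))))" for x
  have q: "q x = r\<^sup>2 - (dist x0 x)\<^sup>2" for x
  proof -
    have "(dist x0 x)\<^sup>2 = (x - x0) \<bullet> (x - x0)"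
      by (simp add: dist_norm power2_norm_eq_inner inner_diff_left inner_diff_right inner_commute)
    also have "\<dots> = (\<Sum>b\<in>Basis. ((x - x0) \<bullet> b) * ((x - x0) \<bullet> b))"
      by (rule euclidean_inner)
    finally show ?thesis
      by (simp add: q_def sum_negf inner_diff_left)
  qed
  define u where "u x = exp_flat 0 (q x) * inverse (exp_flat 0 (r\<^sup>2))" for x
  have "Cinf_on UNIV q"
    unfolding q_def
    by (intro Cinf_on_add Cinf_on_sum Cinf_on_mult Cinf_on_const
        Cinf_on_bounded_linear[OF bounded_linear_inner_left] Cinf_on_id) auto
  then show "Cinf_on UNIV u"
    unfolding u_def
    by (intro Cinf_on_mult Cinf_on_const Cinf_on_compose[OF _ _ Cinf_on_exp_flat]) auto
  show "u x0 = 1"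
    using assms by (simp add: u_def q exp_flat_def)
  show "u x = 0" if "x \<notin> ball x0 r" for x
  proof -
    have "r\<^sup>2 \<le> (dist x0 x)\<^sup>2"
      using that assms by (intro power_mono) auto
    then show ?thesis by (simp add: u_def q exp_flat_def)
  qed
qed

lemma continuous_on_segment:
  fixes B :: "'a::real_normed_vector set"
  assumes "convex B" "y \<in> B" "continuous_on B F"
  shows "continuous_on (B \<times> cbox 0 (1::real)) (\<lambda>(x, t). F (y + t *\<^sub>R (x - y)))"
proof -
  have "y + t *\<^sub>R (x - y) \<in> B" if "x \<in> B" "t \<in> cbox 0 1" for x t
    using convexD_alt[OF assms(1,2) that(1), of t] that(2) by (simp add: algebra_simps)
  then have "continuous_on (B \<times> cbox 0 1) (\<lambda>z. F (y + snd z *\<^sub>R (fst z - y)))"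
    by (intro continuous_on_compose2[OF assms(3)]) (auto intro!: continuous_intros)
  then show ?thesis by (simp add: case_prod_beta')
qed

text \<open>Differentiation under the integral sign brings out a factor \<open>t\<close> from the
  chain rule. The weight \<open>t ^ m\<close> absorbs it, so the derivative has the same shape with
  \<open>m + 1\<close> and the induction closes.\<close>

lemma Ck_on_segment_average:
  fixes F :: "'a::euclidean_space \<Rightarrow> real"
  assumes "convex B" "open B" "y \<in> B"
  shows "Ck_on k B F \<Longrightarrow>
    Ck_on k B (\<lambda>x. integral (cbox 0 1) (\<lambda>t::real. t ^ m * F (y + t *\<^sub>R (x - y))))"
proof (induction k arbitrary: F m)
  have cont: "continuous_on (B \<times> cbox 0 1) (\<lambda>(x, t::real). t ^ m * F (y + t *\<^sub>R (x - y)))"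
    if "continuous_on B F" for F :: "'a \<Rightarrow> real" and m
    using continuous_on_segment[OF assms(1,3) that]
    by (auto simp: case_prod_beta' intro!: continuous_intros)
  {
    case 0
    then show ?case
      using integral_continuous_on_param[OF cont[of F m]] by simp
  next
    case (Suc k)
    define DF where "DF x = frechet_derivative F (at x)" for x
    have DF: "(F has_derivative DF x) (at x)" if "x \<in> B" for x
      unfolding DF_def by (rule Ck_on_Suc_has_derivative[OF Suc.prems that])
    have ckDF: "Ck_on k B (\<lambda>x. DF x v)" for v
      using Suc.prems by (simp add: DF_def)
    have seg: "y + t *\<^sub>R (x - y) \<in> B" if "x \<in> B" "t \<in> cbox 0 1" for x and t :: real
      using convexD_alt[OF assms(1,3) that(1), of t] that(2) by (simp add: algebra_simps)
    \<comment> \<open>The derivative of the integrand, in the form that \<open>leibniz_rule\<close>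
      takes. \<open>Blinfun\<close> has the intended value only where its argument is bounded
      linear, which the fact \<open>L\<close> secures for \<open>x\<close> in
      \<open>B\<close>.\<close>
    define L where "L x t = Blinfun (\<lambda>v. t ^ Suc m * DF (y + t *\<^sub>R (x - y)) v)" for x and t :: real
    have L: "blinfun_apply (L x t) v = t ^ Suc m * DF (y + t *\<^sub>R (x - y)) v"
      if "x \<in> B" "t \<in> cbox 0 1" for x t v
      unfolding L_def
      by (rule bounded_linear_Blinfun_apply[THEN fun_cong], rule bounded_linear_const_mult)
        (rule has_derivative_bounded_linear[OF DF[OF seg[OF that]]])
    have contL: "continuous_on (B \<times> cbox 0 1) (\<lambda>(x, t). L x t)"
    proof (rule continuous_on_blinfun_componentwise)
      fix v :: 'a
      show "continuous_on (B \<times> cbox 0 1) (\<lambda>z. blinfun_apply (case z of (x, t) \<Rightarrow> L x t) v)"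
        using cont[OF Ck_on_imp_continuous_on[OF ckDF[of v]], of "Suc m"]
        by (subst continuous_on_cong[OF refl]) (auto simp: L)
    qed
    show ?case
    proof (rule Ck_on_SucI[OF assms(2)])
      fix x assume x: "x \<in> B"
      have "((\<lambda>x. integral (cbox 0 1) (\<lambda>t::real. t ^ m * F (y + t *\<^sub>R (x - y)))) has_derivative
          blinfun_apply (integral (cbox 0 1) (L x))) (at x within B)"
      proof (rule leibniz_rule[OF _ _ contL x assms(1)])
        fix x and t :: real assume xt: "x \<in> B" "t \<in> cbox 0 1"
        have "((\<lambda>x. t ^ m * F (y + t *\<^sub>R (x - y))) has_derivative
            (\<lambda>v. t ^ m * DF (y + t *\<^sub>R (x - y)) (t *\<^sub>R v))) (at x)"
          by (rule has_derivative_mult_right, rule has_derivative_compose[of "\<lambda>x. y + t *\<^sub>R (x - y)", OF _ DF[OF seg[OF xt]]])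
            (auto intro!: derivative_eq_intros)
        moreover have "t ^ m * DF (y + t *\<^sub>R (x - y)) (t *\<^sub>R v) = blinfun_apply (L x t) v" for v
          using linear_scale[OF has_derivative_linear[OF DF[OF seg[OF xt]]]] by (simp add: L[OF xt])
        ultimately show "((\<lambda>x. t ^ m * F (y + t *\<^sub>R (x - y))) has_derivative blinfun_apply (L x t))
            (at x within B)"
          by (simp add: has_derivative_at_withinI)
      next
        fix x assume x: "x \<in> B"
        have "continuous_on (cbox 0 1) (\<lambda>t::real. case (x, t) of (x, t) \<Rightarrow> t ^ m * F (y + t *\<^sub>R (x - y)))"
          by (rule continuous_on_compose2[OF cont[OF Ck_on_imp_continuous_on[OF Suc.prems]]])
            (use x in \<open>auto intro!: continuous_intros\<close>)
        then have "continuous_on (cbox 0 1) (\<lambda>t::real. t ^ m * F (y + t *\<^sub>R (x - y)))"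
          unfolding prod.case .
        then show "(\<lambda>t. t ^ m * F (y + t *\<^sub>R (x - y))) integrable_on cbox 0 1"
          by (rule integrable_continuous)
      qed
      moreover have "integral (cbox 0 1) (L x) v
          = integral (cbox 0 1) (\<lambda>t. t ^ Suc m * DF (y + t *\<^sub>R (x - y)) v)" for v
      proof -
        have "continuous_on (cbox 0 1) (\<lambda>t. case (x, t) of (x, t) \<Rightarrow> L x t)"
          by (rule continuous_on_compose2[OF contL]) (use x in \<open>auto intro!: continuous_intros\<close>)
        then have "continuous_on (cbox 0 1) (L x)"
          unfolding prod.case .
        then have "L x integrable_on cbox 0 1"
          by (rule integrable_continuous)
        then have "integral (cbox 0 1) (L x) v = integral (cbox 0 1) (\<lambda>t. L x t v)"
          by (rule blinfun_apply_integral)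
        also have "\<dots> = integral (cbox 0 1) (\<lambda>t. t ^ Suc m * DF (y + t *\<^sub>R (x - y)) v)"
          by (rule integral_cong) (rule L[OF x])
        finally show ?thesis .
      qed
      ultimately show "((\<lambda>x. integral (cbox 0 1) (\<lambda>t::real. t ^ m * F (y + t *\<^sub>R (x - y)))) has_derivative
          (\<lambda>v. integral (cbox 0 1) (\<lambda>t. t ^ Suc m * DF (y + t *\<^sub>R (x - y)) v))) (at x)"
        unfolding at_within_open[OF x assms(2)] by (rule has_derivative_eq_rhs[OF _ ext])
    next
      show "Ck_on k B (\<lambda>x. integral (cbox 0 1) (\<lambda>t. t ^ Suc m * DF (y + t *\<^sub>R (x - y)) v))" for v
        by (rule Suc.IH[OF ckDF])
    qed
  }
qed

text \<open>By the fundamental theorem of calculus, \<open>f x - f y\<close> is the integral of the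
  derivative along the segment from \<open>y\<close> to \<open>x\<close>. The witness
  \<open>h b\<close> averages the partial derivative in direction \<open>b\<close> over that
  segment.\<close>

lemma Hadamard_lemma:
  fixes f :: "'a::euclidean_space \<Rightarrow> real"
  assumes "convex B" "open B" "y \<in> B" "Cinf_on B f"
  obtains h :: "'a \<Rightarrow> 'a \<Rightarrow> real"
  where "\<And>b. Cinf_on B (h b)" "\<And>b. h b y = frechet_derivative f (at y) b"
    "\<And>x. x \<in> B \<Longrightarrow> f x = f y + (\<Sum>b\<in>Basis. ((x - y) \<bullet> b) * h b x)"
proof
  let ?D = "\<lambda>x. frechet_derivative f (at x)"
  define h where "h b x = integral (cbox 0 1) (\<lambda>t::real. t ^ 0 * ?D (y + t *\<^sub>R (x - y)) b)" for b x
  show "Cinf_on B (h b)" for b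
    unfolding Cinf_on_def h_def
    by (intro allI Ck_on_segment_average assms Cinf_on_Ck_on Cinf_on_derivative)
  show "h b y = ?D y b" for b
    by (simp add: h_def)
  fix x assume x: "x \<in> B"
  have seg: "y + t *\<^sub>R (x - y) \<in> B" if "t \<in> cbox 0 1" for t :: real
    using convexD_alt[OF assms(1,3) x, of t] that by (simp add: algebra_simps)
  note D = Cinf_on_has_derivative[OF assms(4) seg]
  have "((\<lambda>t. ?D (y + t *\<^sub>R (x - y)) (x - y)) has_integral
      (f (y + 1 *\<^sub>R (x - y)) - f (y + 0 *\<^sub>R (x - y)))) {0..1::real}"
  proof (rule fundamental_theorem_of_calculus)
    fix t :: real assume t: "t \<in> {0..1}"
    then have t': "t \<in> cbox 0 1" by simp
    have "((\<lambda>t. f (y + t *\<^sub>R (x - y))) has_derivative (\<lambda>s. ?D (y + t *\<^sub>R (x - y)) (s *\<^sub>R (x - y))))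
        (at t within {0..1})"
      by (rule has_derivative_compose[of "\<lambda>t. y + t *\<^sub>R (x - y)", OF _ D[OF t']]) (auto intro!: derivative_eq_intros)
    then show "((\<lambda>t. f (y + t *\<^sub>R (x - y))) has_vector_derivative ?D (y + t *\<^sub>R (x - y)) (x - y))
        (at t within {0..1})"
      using linear_scale[OF has_derivative_linear[OF D[OF t']]]
      by (simp add: has_vector_derivative_def)
  qed simp
  then have "f x - f y = integral (cbox 0 1) (\<lambda>t. ?D (y + t *\<^sub>R (x - y)) (x - y))"
    by (simp add: integral_unique)
  also have "\<dots> = integral (cbox 0 1)
      (\<lambda>t. \<Sum>b\<in>Basis. ((x - y) \<bullet> b) * (t ^ 0 * ?D (y + t *\<^sub>R (x - y)) b))"
  proof (rule integral_cong)
    fix t :: real assume "t \<in> cbox 0 1"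
    from Linear_Algebra.linear_componentwise[OF has_derivative_linear[OF D[OF this]], of "x - y" 1]
    show "?D (y + t *\<^sub>R (x - y)) (x - y)
        = (\<Sum>b\<in>Basis. ((x - y) \<bullet> b) * (t ^ 0 * ?D (y + t *\<^sub>R (x - y)) b))"
      by simp
  qed
  also have "\<dots> = (\<Sum>b\<in>Basis. ((x - y) \<bullet> b) * h b x)"
  proof (subst integral_sum)
    fix b :: 'a
    have "continuous_on (cbox 0 1) (\<lambda>t. ?D (y + t *\<^sub>R (x - y)) b)"
      by (rule continuous_on_compose2[OF Ck_on_imp_continuous_on[OF Cinf_on_Ck_on[OF
              Cinf_on_derivative[OF assms(4)]]]])
        (use seg in \<open>auto intro!: continuous_intros\<close>)
    then show "(\<lambda>t. ((x - y) \<bullet> b) * (t ^ 0 * ?D (y + t *\<^sub>R (x - y)) b)) integrable_on cbox 0 1"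
      by (intro integrable_continuous continuous_intros) simp
  qed (simp_all add: h_def)
  finally show "f x = f y + (\<Sum>b\<in>Basis. ((x - y) \<bullet> b) * h b x)" by simp
qed

section \<open>Smooth functions and tangent vectors on a manifold\<close>

lemma sum_fun_apply: "(\<Sum>i\<in>I. F i) x = (\<Sum>i\<in>I. F i x)"
  by (induction I rule: infinite_finite_induct) auto

lemma scaleR_fun_apply [simp]: "(c *\<^sub>R f) x = c *\<^sub>R f x"
  by (simp add: scaleR_fun_def)

locale manifold =
  fixes A :: "('m::{t2_space, second_countable_topology}, 'e::euclidean_space) atlas"
  assumes smooth_manifold: "smooth_manifold A"
begin

lemma
  assumes "(U, \<psi>) \<in> A"
  shows chart_open: "open U"
    and chart_image_open: "open (\<psi> ` U)"
    and chart_inj: "inj_on \<psi> U"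
    and chart_inv_continuous: "continuous_on (\<psi> ` U) (inv_into U \<psi>)"
proof -
  obtain \<psi>' where *: "open U" "open (\<psi> ` U)" "homeomorphism U (\<psi> ` U) \<psi> \<psi>'"
    using smooth_manifold assms unfolding smooth_manifold_def by blast
  show "open U" "open (\<psi> ` U)" by fact+
  show inj: "inj_on \<psi> U"
    using *(3) by (metis homeomorphism_apply1 inj_onI)
  have "\<psi>' y = inv_into U \<psi> y" if "y \<in> \<psi> ` U" for y
    using that *(3) inj by (metis homeomorphism_apply1 imageE inv_into_f_f)
  then show "continuous_on (\<psi> ` U) (inv_into U \<psi>)"
    using continuous_on_cong[OF refl, of "\<psi> ` U" \<psi>' "inv_into U \<psi>"] homeomorphism_cont2[OF *(3)] by simp
qed

lemma chart_transition:
  "(U, \<psi>) \<in> A \<Longrightarrow> (V, \<theta>) \<in> A \<Longrightarrow> Cinf_on (\<psi> ` (U \<inter> V)) (\<theta> \<circ> inv_into U \<psi>)"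
  using smooth_manifold unfolding smooth_manifold_def by blast

lemma chart_at: obtains U \<psi> where "(U, \<psi>) \<in> A" "p \<in> U"
  using smooth_manifold unfolding smooth_manifold_def by blast

lemma chart_image_open_subset:
  assumes "(U, \<psi>) \<in> A" "open W" "W \<subseteq> U"
  shows "open (\<psi> ` W)"
proof -
  have "\<psi> ` W = \<psi> ` U \<inter> inv_into U \<psi> -` W"
    using chart_inj[OF assms(1)] assms(3) by (auto simp: inv_into_f_f subset_iff)
  then show ?thesis
    using continuous_open_preimage[OF chart_inv_continuous chart_image_open assms(2)] assms(1) by metis
qed

lemma smooth_fun_chart:
  "smooth_fun A f \<Longrightarrow> (U, \<psi>) \<in> A \<Longrightarrow> Cinf_on (\<psi> ` U) (f \<circ> inv_into U \<psi>)"
  unfolding smooth_fun_def by blast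

lemma smooth_fun_const: "smooth_fun A (\<lambda>q. c)"
  unfolding smooth_fun_def by (auto simp: o_def intro!: Cinf_on_const chart_image_open)

lemma smooth_fun_add: "smooth_fun A f \<Longrightarrow> smooth_fun A h \<Longrightarrow> smooth_fun A (\<lambda>q. f q + h q)"
  unfolding smooth_fun_def using chart_image_open by (force simp: o_def intro!: Cinf_on_add)

lemma smooth_fun_mult: "smooth_fun A f \<Longrightarrow> smooth_fun A h \<Longrightarrow> smooth_fun A (\<lambda>q. f q * h q)"
  unfolding smooth_fun_def using chart_image_open by (force simp: o_def intro!: Cinf_on_mult)

lemma smooth_fun_diff: "smooth_fun A f \<Longrightarrow> smooth_fun A h \<Longrightarrow> smooth_fun A (\<lambda>q. f q - h q)"
  using smooth_fun_add[of f "\<lambda>q. - 1 * h q"] smooth_fun_mult[OF smooth_fun_const, of h "- 1"] by simp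

lemma smooth_fun_sum:
  "(\<And>i. i \<in> I \<Longrightarrow> smooth_fun A (f i)) \<Longrightarrow> smooth_fun A (\<lambda>q. \<Sum>i\<in>I. f i q)"
  by (induction I rule: infinite_finite_induct) (auto intro: smooth_fun_add smooth_fun_const)

text \<open>The part \<open>C\<close> of \<open>U\<close> that lies over \<open>K\<close> is
  compact, hence closed by the Hausdorff property. Any chart domain \<open>V\<close> is thus covered
  by the open sets \<open>V \<inter> U\<close> and \<open>V - C\<close>: on the first the function
  is \<open>w\<close> after a transition map, on the second it is \<open>0\<close>.\<close>

lemma smooth_fun_extend_zero:
  assumes chart: "(U, \<psi>) \<in> A" and w: "Cinf_on UNIV w" "\<And>x. x \<notin> K \<Longrightarrow> w x = 0"
    and K: "compact K" "K \<subseteq> \<psi> ` U"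
  shows "smooth_fun A (\<lambda>q. if q \<in> U then w (\<psi> q) else 0)" (is "smooth_fun A ?F")
proof -
  define C where "C = inv_into U \<psi> ` K"
  have "compact C"
    unfolding C_def
    using compact_continuous_image continuous_on_subset[OF chart_inv_continuous[OF chart] K(2)] K(1) by blast
  then have C: "closed C" by (rule compact_imp_closed)
  have "C \<subseteq> U"
    unfolding C_def using K(2) by (auto intro: inv_into_into)
  show ?thesis
    unfolding smooth_fun_def
  proof clarify
    fix V :: "'m set" and \<theta> assume V: "(V, \<theta>) \<in> A"
    note inv = inv_into_f_f[OF chart_inj[OF V]]
    have o1: "open (\<theta> ` (V \<inter> U))" and o2: "open (\<theta> ` (V - C))"
      using chart_open[OF V] chart_open[OF chart] C by (auto intro!: chart_image_open_subset[OF V])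
    have "Cinf_on (\<theta> ` (V \<inter> U)) (\<lambda>y. w ((\<psi> \<circ> inv_into V \<theta>) y))"
      by (rule Cinf_on_compose[OF o1 _ w(1) chart_transition[OF V chart]]) simp
    then have 1: "Cinf_on (\<theta> ` (V \<inter> U)) (?F \<circ> inv_into V \<theta>)"
      by (rule Cinf_on_cong[OF o1]) (auto simp: inv)
    have 2: "Cinf_on (\<theta> ` (V - C)) (?F \<circ> inv_into V \<theta>)"
    proof (rule Cinf_on_cong[OF o2 Cinf_on_const[OF o2, of 0]])
      fix y assume "y \<in> \<theta> ` (V - C)"
      then obtain q where q: "q \<in> V" "q \<notin> C" "y = \<theta> q" by blast
      have "\<psi> q \<notin> K" if "q \<in> U"
        using q(2) inv_into_f_f[OF chart_inj[OF chart] that] by (force simp: C_def)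
      then show "0 = (?F \<circ> inv_into V \<theta>) y"
        using q by (simp add: inv w(2))
    qed
    have "\<theta> ` V = \<theta> ` (V \<inter> U) \<union> \<theta> ` (V - C)"
      using \<open>C \<subseteq> U\<close> by auto
    then show "Cinf_on (\<theta> ` V) (?F \<circ> inv_into V \<theta>)"
      using Cinf_on_Un[OF o1 o2 1 2] by simp
  qed
qed

section \<open>Derivations at a point and a local frame\<close>

lemma
  assumes "v \<in> tangent_space A p"
  shows tangent_add: "smooth_fun A f \<Longrightarrow> smooth_fun A h \<Longrightarrow> v (\<lambda>q. f q + h q) = v f + v h"
    and tangent_scale: "smooth_fun A f \<Longrightarrow> v (\<lambda>q. c * f q) = c * v f"
    and tangent_mult: "smooth_fun A f \<Longrightarrow> smooth_fun A h \<Longrightarrow>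
      v (\<lambda>q. f q * h q) = f p * v h + h p * v f"
    and tangent_not_smooth: "\<not> smooth_fun A f \<Longrightarrow> v f = 0"
  using assms by (auto simp: tangent_space_def)

text \<open>The Leibniz rule for \<open>1 * 1\<close> gives \<open>v 1 = 2 * v 1\<close>.\<close>

lemma tangent_const: "v \<in> tangent_space A p \<Longrightarrow> v (\<lambda>q. c) = 0"
  using tangent_mult[of v p "\<lambda>_. 1" "\<lambda>_. 1"] tangent_scale[of v p "\<lambda>_. 1" c]
  by (simp add: smooth_fun_const)

lemma tangent_diff:
  "v \<in> tangent_space A p \<Longrightarrow> smooth_fun A f \<Longrightarrow> smooth_fun A h \<Longrightarrow> v (\<lambda>q. f q - h q) = v f - v h"
  using tangent_add[of v p f "\<lambda>q. - 1 * h q"] tangent_scale[of v p h "- 1"]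
    smooth_fun_mult[OF smooth_fun_const, of h "- 1"] by simp

lemma tangent_sum:
  assumes "v \<in> tangent_space A p"
  shows "(\<And>i. i \<in> I \<Longrightarrow> smooth_fun A (f i)) \<Longrightarrow> v (\<lambda>q. \<Sum>i\<in>I. f i q) = (\<Sum>i\<in>I. v (f i))"
  by (induction I rule: infinite_finite_induct)
    (auto simp: tangent_add[OF assms] tangent_const[OF assms] smooth_fun_sum)

text \<open>
  A cut-off coordinate frame.  With \<open>\<rho>\<close> a bump function supported in a chart with coordinates
  \<open>x\<^sub>b\<close>, the witnesses are \<open>c b = \<rho> x\<^sub>b\<close> and \<open>E b = \<rho> \<partial>\<^sub>b\<close>; the factor \<open>\<rho>\<^sup>3\<close> keeps every coefficient
  globally smooth.
\<close>

lemma local_frame: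
  obtains \<rho> :: "'m \<Rightarrow> real" and c :: "'e \<Rightarrow> 'm \<Rightarrow> real" and E :: "'e \<Rightarrow> 'm vfield"
  where "smooth_fun A \<rho>" "\<rho> p = 1" "\<And>b. smooth_fun A (c b)" "\<And>b. vector_field A (E b)"
    "\<And>q v. v \<in> tangent_space A q \<Longrightarrow>
      \<rho> q ^ 3 *\<^sub>R v = (\<Sum>b\<in>Basis. (\<rho> q * v (c b) - c b q * v \<rho>) *\<^sub>R E b q)"
proof -
  obtain U \<psi> where chart: "(U, \<psi>) \<in> A" and p: "p \<in> U" by (rule chart_at)
  note inv = inv_into_f_f[OF chart_inj[OF chart]]
  obtain R where R: "R > 0" "ball (\<psi> p) R \<subseteq> \<psi> ` U"
    using chart_image_open[OF chart] p open_contains_ball by blast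
  define B where "B = ball (\<psi> p) R"
  define K where "K = cball (\<psi> p) (R / 2)"
  have B: "open B" "convex B" "B \<subseteq> \<psi> ` U" and K: "compact K" "K \<subseteq> B"
    using R by (auto simp: B_def K_def)
  obtain u :: "'e \<Rightarrow> real" where u: "Cinf_on UNIV u" "u (\<psi> p) = 1" "\<And>x. x \<notin> ball (\<psi> p) (R / 2) \<Longrightarrow> u x = 0"
    by (rule smooth_bump_exists[OF half_gt_zero[OF R(1)], of "\<psi> p"]) blast
  have u0: "u x = 0" if "x \<notin> K" for x
    using that u(3) by (auto simp: K_def)
  \<comment> \<open>In the chart this is the product \<open>u h\<close>. As \<open>u\<close>
    vanishes off \<open>K\<close>, which lies inside \<open>B\<close>, smoothness of
    \<open>h\<close> on \<open>B\<close> suffices for smoothness on the whole manifold.\<close>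
  define loc where "loc h q = (if q \<in> U then u (\<psi> q) * h (\<psi> q) else 0)" for h and q
  have loc: "smooth_fun A (loc h)" if h: "Cinf_on B h" for h
  proof -
    have "open (- K)" using K(1) by (simp add: compact_imp_closed open_Compl)
    moreover have "Cinf_on B (\<lambda>x. u x * h x)"
      by (intro Cinf_on_mult B(1) h Cinf_on_subset[OF u(1)]) simp
    moreover have "Cinf_on (- K) (\<lambda>x. u x * h x)"
      by (rule Cinf_on_cong[OF \<open>open (- K)\<close> Cinf_on_const[OF \<open>open (- K)\<close>, of 0]]) (simp add: u0)
    ultimately have "Cinf_on (B \<union> - K) (\<lambda>x. u x * h x)"
      using Cinf_on_Un B(1) by blast
    moreover have "B \<union> - K = UNIV" using K(2) by blast
    ultimately have "Cinf_on UNIV (\<lambda>x. u x * h x)" by simp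
    from smooth_fun_extend_zero[OF chart this, of K] K B(3) u0 show ?thesis
      unfolding loc_def by auto
  qed
  let ?D = "\<lambda>f y. frechet_derivative (f \<circ> inv_into U \<psi>) (at y)"
  have D: "((f \<circ> inv_into U \<psi>) has_derivative ?D f (\<psi> q)) (at (\<psi> q))"
    if "smooth_fun A f" "q \<in> U" for f q
    using Cinf_on_has_derivative[OF smooth_fun_chart[OF that(1) chart]] that(2) by blast
  define \<rho> where "\<rho> = loc (\<lambda>x. 1)"
  define c where "c b = loc (\<lambda>x. x \<bullet> b)" for b
  \<comment> \<open>Non-smooth functions are sent to \<open>0\<close>, as
    \<open>tangent_space\<close> demands.\<close>
  define E where "E b q f = (if smooth_fun A f then loc (\<lambda>y. ?D f y b) q else 0)" for b q f
  have smooth_\<rho>: "smooth_fun A \<rho>"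
    unfolding \<rho>_def by (intro loc Cinf_on_const B(1))
  have smooth_c: "smooth_fun A (c b)" for b
    unfolding c_def by (intro loc Cinf_on_bounded_linear[OF bounded_linear_inner_left] Cinf_on_id B(1))
  have field_E: "vector_field A (E b)" for b
    unfolding vector_field_def
  proof (intro conjI allI impI)
    fix f assume f: "smooth_fun A f"
    have "smooth_fun A (loc (\<lambda>y. ?D f y b))"
      by (intro loc Cinf_on_derivative Cinf_on_subset[OF smooth_fun_chart[OF f chart] B(3)])
    then show "smooth_fun A (\<lambda>q. E b q f)"
      by (simp add: E_def f)
  next
    fix q
    show "E b q \<in> tangent_space A q"
    proof (cases "q \<in> U")
      case False
      then show ?thesis by (simp add: tangent_space_def E_def loc_def)
    next
      case True
      have "?D (\<lambda>q. f q + h q) (\<psi> q) = (\<lambda>v. ?D f (\<psi> q) v + ?D h (\<psi> q) v)"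
        if "smooth_fun A f" "smooth_fun A h" for f h
        using frechet_derivative_eq[OF has_derivative_add[OF D[OF that(1) True] D[OF that(2) True]]]
        by (simp add: o_def)
      moreover have "?D (\<lambda>q. k * f q) (\<psi> q) = (\<lambda>v. k * ?D f (\<psi> q) v)"
        if "smooth_fun A f" for k f
        using frechet_derivative_eq[OF has_derivative_mult_right[OF D[OF that True], of k]]
        by (simp add: o_def)
      moreover have "?D (\<lambda>q. f q * h q) (\<psi> q) = (\<lambda>v. f q * ?D h (\<psi> q) v + ?D f (\<psi> q) v * h q)"
        if "smooth_fun A f" "smooth_fun A h" for f h
        using frechet_derivative_eq[OF has_derivative_mult[OF D[OF that(1) True] D[OF that(2) True]]]
        by (simp add: o_def inv[OF True])
      ultimately show ?thesis
        using True unfolding tangent_space_def E_def loc_def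
        by (auto simp: smooth_fun_add smooth_fun_mult smooth_fun_const algebra_simps)
    qed
  qed
  have frame: "\<rho> q ^ 3 *\<^sub>R v = (\<Sum>b\<in>Basis. (\<rho> q * v (c b) - c b q * v \<rho>) *\<^sub>R E b q)"
    if v: "v \<in> tangent_space A q" for q v
  proof (rule ext)
    fix f
    show "(\<rho> q ^ 3 *\<^sub>R v) f = (\<Sum>b\<in>Basis. (\<rho> q * v (c b) - c b q * v \<rho>) *\<^sub>R E b q) f"
    proof (cases "smooth_fun A f \<and> \<rho> q \<noteq> 0")
      case False
      then have "E b q f = 0" for b
        by (auto simp: E_def \<rho>_def loc_def split: if_splits)
      then show ?thesis
        using False tangent_not_smooth[OF v, of f] by (auto simp: sum_fun_apply)
    next
      case True
      then have f: "smooth_fun A f" and q: "q \<in> U" and uq: "u (\<psi> q) \<noteq> 0"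
        by (auto simp: \<rho>_def loc_def split: if_splits)
      define y where "y = \<psi> q"
      have y: "y \<in> B"
        using uq u0 K(2) unfolding y_def by blast
      have vals: "\<rho> q = u y" "\<And>b. c b q = u y * (y \<bullet> b)"
        using q by (simp_all add: \<rho>_def c_def loc_def y_def)
      obtain h where h: "\<And>b. Cinf_on B (h b)" "\<And>b. h b y = ?D f y b"
        "\<And>x. x \<in> B \<Longrightarrow> (f \<circ> inv_into U \<psi>) x
          = (f \<circ> inv_into U \<psi>) y + (\<Sum>b\<in>Basis. ((x - y) \<bullet> b) * h b x)"
        using Hadamard_lemma[OF B(2,1) y Cinf_on_subset[OF smooth_fun_chart[OF f chart] B(3)]] by metis
      define H where "H b = loc (h b)" for b
      have H: "smooth_fun A (H b)" for b
        unfolding H_def by (rule loc[OF h(1)])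
      have EH: "H b q = E b q f" for b
        using q f by (simp add: H_def E_def loc_def h(2)[unfolded y_def])
      note smooth = smooth_fun_const smooth_fun_mult smooth_fun_diff smooth_\<rho> smooth_c H f
      \<comment> \<open>Hadamard's expansion around \<open>y\<close>, multiplied by \<open>u\<close>
        twice: one factor turns the coordinate differences into
        \<open>c b - (y \<bullet> b) * \<rho>\<close>, the other turns \<open>h b\<close> into
        \<open>H b\<close>. Both sides vanish where \<open>u\<close> does, so the identity is global
        and \<open>v\<close> can be applied to it.\<close>
      have "\<rho> q' * \<rho> q' * (f q' - f q) = (\<Sum>b\<in>Basis. (c b q' - (y \<bullet> b) * \<rho> q') * H b q')" for q'
      proof (cases "q' \<in> U \<and> \<psi> q' \<in> B")
        case True
        then have "f q' - f q = (\<Sum>b\<in>Basis. ((\<psi> q' - y) \<bullet> b) * h b (\<psi> q'))"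
          using h(3)[of "\<psi> q'"] q by (simp add: inv y_def)
        then show ?thesis
          using True by (simp add: \<rho>_def c_def H_def loc_def sum_distrib_left algebra_simps inner_diff_left)
      next
        case False
        then have "\<psi> q' \<notin> K" if "q' \<in> U"
          using that K(2) by blast
        then show ?thesis
          by (auto simp: \<rho>_def c_def H_def loc_def u0)
      qed
      then have "v (\<lambda>q'. \<rho> q' * \<rho> q' * (f q' - f q))
          = v (\<lambda>q'. \<Sum>b\<in>Basis. (c b q' - (y \<bullet> b) * \<rho> q') * H b q')"
        by presburger
      also have "\<dots> = (\<Sum>b\<in>Basis. v (\<lambda>q'. (c b q' - (y \<bullet> b) * \<rho> q') * H b q'))"
        by (intro tangent_sum[OF v] smooth)
      \<comment> \<open>The first factor of each summand is zero at \<open>q\<close>, so the Leibniz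
        rule keeps only its derivative.\<close>
      also have "\<dots> = (\<Sum>b\<in>Basis. (v (c b) - (y \<bullet> b) * v \<rho>) * E b q f)"
        by (intro sum.cong refl)
          (simp add: tangent_mult[OF v] tangent_diff[OF v] tangent_const[OF v] smooth EH vals)
      finally have *: "\<rho> q * \<rho> q * v f = (\<Sum>b\<in>Basis. (v (c b) - (y \<bullet> b) * v \<rho>) * E b q f)"
        by (simp add: tangent_mult[OF v] tangent_diff[OF v] tangent_const[OF v] smooth)
      \<comment> \<open>The third factor absorbs the number \<open>y \<bullet> b\<close> into
        \<open>c b q = \<rho> q * (y \<bullet> b)\<close>, a smooth function of
        \<open>q\<close>.\<close>
      have "\<rho> q ^ 3 * v f = \<rho> q * (\<rho> q * \<rho> q * v f)"
        by (simp add: power3_eq_cube)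
      then show ?thesis
        unfolding * by (simp add: sum_fun_apply sum_distrib_left vals algebra_simps)
    qed
  qed
  have "\<rho> p = 1"
    using p u(2) by (simp add: \<rho>_def loc_def)
  then show ?thesis
    using that smooth_\<rho> smooth_c field_E frame by blast
qed

end

section \<open>Curvature of the Levi-Civita connection\<close>

context manifold
begin

lemma tangent_space_zero [simp]: "0 \<in> tangent_space A p"
  by (simp add: tangent_space_def)

lemma tangent_space_add [simp]:
  "v \<in> tangent_space A p \<Longrightarrow> w \<in> tangent_space A p \<Longrightarrow> v + w \<in> tangent_space A p"
  by (auto simp: tangent_space_def algebra_simps)

lemma tangent_space_scaleR [simp]:
  "v \<in> tangent_space A p \<Longrightarrow> c *\<^sub>R v \<in> tangent_space A p"
  by (auto simp: tangent_space_def algebra_simps)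

lemma tangent_space_minus [simp]: "v \<in> tangent_space A p \<Longrightarrow> - v \<in> tangent_space A p"
  using tangent_space_scaleR[of v p "- 1"] by simp

lemma tangent_space_diff [simp]:
  "v \<in> tangent_space A p \<Longrightarrow> w \<in> tangent_space A p \<Longrightarrow> v - w \<in> tangent_space A p"
  using tangent_space_add[of v p "- w"] by simp

lemma vector_field_at [simp]: "vector_field A X \<Longrightarrow> X p \<in> tangent_space A p"
  by (simp add: vector_field_def)

lemma vector_field_smooth: "vector_field A X \<Longrightarrow> smooth_fun A f \<Longrightarrow> smooth_fun A (\<lambda>p. X p f)"
  by (simp add: vector_field_def)

lemma vector_field_add [simp]: "vector_field A X \<Longrightarrow> vector_field A Y \<Longrightarrow> vector_field A (X + Y)"
  by (auto simp: vector_field_def intro: smooth_fun_add)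

lemma vector_field_scale [simp]:
  "smooth_fun A f \<Longrightarrow> vector_field A X \<Longrightarrow> vector_field A (\<lambda>p. f p *\<^sub>R X p)"
  by (auto simp: vector_field_def intro: smooth_fun_mult)

lemma vector_field_scaleR [simp]: "vector_field A X \<Longrightarrow> vector_field A (c *\<^sub>R X)"
  using vector_field_scale[OF smooth_fun_const, of X c] by (simp add: scaleR_fun_def)

lemma vector_field_minus [simp]: "vector_field A X \<Longrightarrow> vector_field A (- X)"
  using vector_field_scaleR[of X "- 1"] by simp

lemma vector_field_diff [simp]: "vector_field A X \<Longrightarrow> vector_field A Y \<Longrightarrow> vector_field A (X - Y)"
  using vector_field_add[of X "- Y"] by simp

lemma vector_field_zero [simp]: "vector_field A 0"
  by (simp add: vector_field_def smooth_fun_const)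

lemma vector_field_sum:
  "(\<And>i. i \<in> I \<Longrightarrow> vector_field A (X i)) \<Longrightarrow> vector_field A (\<Sum>i\<in>I. X i)"
  by (induction I rule: infinite_finite_induct) auto

text \<open>At \<open>p\<close>, where \<open>\<rho>\<close> is \<open>1\<close>, the frame identity
  writes \<open>v\<close> as a combination of the vectors \<open>E b p\<close>; keeping its
  coefficients as constants gives a global field.\<close>

lemma vector_field_extension:
  assumes "v \<in> tangent_space A p"
  obtains X where "vector_field A X" "X p = v"
proof (rule local_frame[of p])
  fix \<rho> c and E :: "'e \<Rightarrow> 'm vfield"
  assume *: "\<rho> p = 1" "\<And>b. vector_field A (E b)"
    "\<And>q v. v \<in> tangent_space A q \<Longrightarrow>
      \<rho> q ^ 3 *\<^sub>R v = (\<Sum>b\<in>Basis. (\<rho> q * v (c b) - c b q * v \<rho>) *\<^sub>R E b q)"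
  let ?X = "\<Sum>b\<in>Basis. (v (c b) - c b p * v \<rho>) *\<^sub>R E b"
  have "vector_field A ?X"
    by (intro vector_field_sum vector_field_scaleR *)
  moreover have "?X p = v"
    using *(3)[OF assms] by (simp add: sum_fun_apply *(1))
  ultimately show thesis by (rule that)
qed

text \<open>Multiplication by the cube of \<open>\<rho>\<close> does not change \<open>T X\<close>,
  because \<open>\<rho> p = 1\<close>, but makes \<open>X\<close> a combination of the frame fields.
  Its smooth coefficients \<open>a b\<close> vanish at \<open>p\<close> together with
  \<open>X p\<close>.\<close>

lemma tensorial_vanishes:
  fixes T :: "'m vfield \<Rightarrow> 'v::real_vector"
  assumes add: "\<And>X Y. vector_field A X \<Longrightarrow> vector_field A Y \<Longrightarrow> T (X + Y) = T X + T Y"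
    and scale: "\<And>f X. smooth_fun A f \<Longrightarrow> vector_field A X \<Longrightarrow> T (\<lambda>q. f q *\<^sub>R X q) = f p *\<^sub>R T X"
    and X: "vector_field A X" "X p = 0"
  shows "T X = 0"
proof (rule local_frame[of p])
  fix \<rho> c and E :: "'e \<Rightarrow> 'm vfield"
  assume \<rho>: "smooth_fun A \<rho>" "\<rho> p = 1" and c: "\<And>b. smooth_fun A (c b)"
    and E: "\<And>b. vector_field A (E b)"
    and frame: "\<And>q v. v \<in> tangent_space A q \<Longrightarrow>
      \<rho> q ^ 3 *\<^sub>R v = (\<Sum>b\<in>Basis. (\<rho> q * v (c b) - c b q * v \<rho>) *\<^sub>R E b q)"
  define a where "a b q = \<rho> q * X q (c b) - c b q * X q \<rho>" for b q
  have a: "smooth_fun A (a b)" for b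
    unfolding a_def
    by (intro smooth_fun_diff smooth_fun_mult vector_field_smooth[OF X(1)] \<rho> c)
  have T0: "T 0 = 0"
    using scale[OF smooth_fun_const X(1), of 0] by (simp add: zero_fun_def)
  have T_sum: "T (\<Sum>i\<in>I. F i) = (\<Sum>i\<in>I. T (F i))"
    if "\<And>i. i \<in> I \<Longrightarrow> vector_field A (F i)" for I :: "'e set" and F
    using that by (induction I rule: infinite_finite_induct) (auto simp: add vector_field_sum T0)
  have "(\<lambda>q. (\<rho> q * \<rho> q * \<rho> q) *\<^sub>R X q) = (\<Sum>b\<in>Basis. (\<lambda>q. a b q *\<^sub>R E b q))"
  proof
    fix q
    show "(\<rho> q * \<rho> q * \<rho> q) *\<^sub>R X q = (\<Sum>b\<in>Basis. (\<lambda>q. a b q *\<^sub>R E b q)) q"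
      using frame[OF vector_field_at[OF X(1)], of q]
      by (simp add: sum_fun_apply a_def power3_eq_cube)
  qed
  then have "T (\<lambda>q. (\<rho> q * \<rho> q * \<rho> q) *\<^sub>R X q) = (\<Sum>b\<in>Basis. a b p *\<^sub>R T (E b))"
    by (simp add: T_sum a E scale)
  moreover have "T (\<lambda>q. (\<rho> q * \<rho> q * \<rho> q) *\<^sub>R X q) = T X"
    by (subst scale) (simp_all add: smooth_fun_mult \<rho> X(1))
  ultimately show "T X = 0"
    by (simp add: a_def X(2))
qed

lemma tensorial_cong:
  fixes T :: "'m vfield \<Rightarrow> 'v::real_vector"
  assumes add: "\<And>X Y. vector_field A X \<Longrightarrow> vector_field A Y \<Longrightarrow> T (X + Y) = T X + T Y"
    and scale: "\<And>f X. smooth_fun A f \<Longrightarrow> vector_field A X \<Longrightarrow> T (\<lambda>q. f q *\<^sub>R X q) = f p *\<^sub>R T X"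
    and XY: "vector_field A X" "vector_field A Y" "X p = Y p"
  shows "T X = T Y"
proof -
  have "T (X - Y) = 0"
    by (rule tensorial_vanishes[of T p]) (use assms in simp_all)
  then show ?thesis
    using add[of "X - Y" Y] XY by simp
qed

lemma Jacobi_identity:
  assumes X: "vector_field A X" and Y: "vector_field A Y" and Z: "vector_field A Z"
  shows "lie_bracket X (lie_bracket Y Z) + lie_bracket Y (lie_bracket Z X)
    + lie_bracket Z (lie_bracket X Y) = 0"
proof (intro ext)
  fix p f
  note V = vector_field_at[OF X] vector_field_at[OF Y] vector_field_at[OF Z]
  show "(lie_bracket X (lie_bracket Y Z) + lie_bracket Y (lie_bracket Z X)
    + lie_bracket Z (lie_bracket X Y)) p f = 0 p f"
  proof (cases "smooth_fun A f")
    case True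
    note s = vector_field_smooth[OF X] vector_field_smooth[OF Y] vector_field_smooth[OF Z] True
    show ?thesis
      by (simp add: lie_bracket_def tangent_diff[OF V(1)] tangent_diff[OF V(2)] tangent_diff[OF V(3)] s)
  next
    \<comment> \<open>Each inner function is then identically \<open>0\<close>, so the outer
      derivations act on a constant.\<close>
    case False
    then show ?thesis
      by (simp add: lie_bracket_def tangent_not_smooth[OF V(1)] tangent_not_smooth[OF V(2)]
          tangent_not_smooth[OF V(3)] tangent_const[OF V(1)] tangent_const[OF V(2)] tangent_const[OF V(3)])
  qed
qed

end

section \<open>Calculus with the metric and the connection\<close>

locale pseudo_riemannian_manifold = manifold A
  for A :: "('m::{t2_space, second_countable_topology}, 'e::euclidean_space) atlas" +
  fixes g :: "'m \<Rightarrow> 'm tvec \<Rightarrow> 'm tvec \<Rightarrow> real"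
    and nabla :: "'m vfield \<Rightarrow> 'm vfield \<Rightarrow> 'm vfield"
  assumes metric: "pseudo_riemannian_metric A g"
    and levi_civita: "levi_civita A g nabla"
begin

abbreviation T where "T \<equiv> tangent_space A"
abbreviation vf where "vf \<equiv> vector_field A"
abbreviation R where "R \<equiv> curvature nabla"

lemmas metric_axioms = metric[unfolded pseudo_riemannian_metric_def]

lemma
  assumes "x \<in> T p" "z \<in> T p"
  shows g_add_left [simp]: "y \<in> T p \<Longrightarrow> g p (x + y) z = g p x z + g p y z"
    and g_scale_left [simp]: "g p (c *\<^sub>R x) z = c * g p x z"
  using metric_axioms[THEN conjunct1] assms by blast+

lemma g_commute: "x \<in> T p \<Longrightarrow> y \<in> T p \<Longrightarrow> g p x y = g p y x"
  using metric_axioms[THEN conjunct2, THEN conjunct1] by blast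

lemma g_nondegenerate: "x \<in> T p \<Longrightarrow> (\<And>y. y \<in> T p \<Longrightarrow> g p x y = 0) \<Longrightarrow> x = 0"
  using metric_axioms[THEN conjunct2, THEN conjunct2, THEN conjunct1] by blast

lemma g_smooth: "vf X \<Longrightarrow> vf Y \<Longrightarrow> smooth_fun A (\<lambda>p. g p (X p) (Y p))"
  using metric_axioms by blast

lemma g_add_right [simp]: "x \<in> T p \<Longrightarrow> y \<in> T p \<Longrightarrow> z \<in> T p \<Longrightarrow> g p z (x + y) = g p z x + g p z y"
  by (simp add: g_commute[of z])

lemma g_scale_right [simp]: "x \<in> T p \<Longrightarrow> z \<in> T p \<Longrightarrow> g p z (c *\<^sub>R x) = c * g p z x"
  by (simp add: g_commute[of z])

lemma g_zero_right [simp]: "x \<in> T p \<Longrightarrow> g p x 0 = 0"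
  using g_scale_right[of 0 p x 0] by simp

lemma g_minus_left [simp]: "x \<in> T p \<Longrightarrow> y \<in> T p \<Longrightarrow> g p (- x) y = - g p x y"
  using g_scale_left[of x p y "- 1"] by simp

lemma g_minus_right [simp]: "x \<in> T p \<Longrightarrow> y \<in> T p \<Longrightarrow> g p y (- x) = - g p y x"
  using g_scale_right[of x p y "- 1"] by simp

lemma g_diff_left [simp]: "x \<in> T p \<Longrightarrow> y \<in> T p \<Longrightarrow> z \<in> T p \<Longrightarrow> g p (x - y) z = g p x z - g p y z"
  using g_add_left[of x p z "- y"] by simp

lemma g_diff_right [simp]: "x \<in> T p \<Longrightarrow> y \<in> T p \<Longrightarrow> z \<in> T p \<Longrightarrow> g p z (x - y) = g p z x - g p z y"
  using g_add_right[of x p "- y" z] by simp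

lemma nabla_field [simp]: "vf X \<Longrightarrow> vf Y \<Longrightarrow> vf (nabla X Y)"
  and nabla_add_left: "vf X \<Longrightarrow> vf Y \<Longrightarrow> vf Z \<Longrightarrow> nabla (X + Y) Z = nabla X Z + nabla Y Z"
  and nabla_add_right: "vf X \<Longrightarrow> vf Y \<Longrightarrow> vf Z \<Longrightarrow> nabla X (Y + Z) = nabla X Y + nabla X Z"
  and nabla_scale_left: "smooth_fun A f \<Longrightarrow> vf X \<Longrightarrow> vf Y \<Longrightarrow>
    nabla (\<lambda>p. f p *\<^sub>R X p) Y = (\<lambda>p. f p *\<^sub>R nabla X Y p)"
  and nabla_scale_right: "smooth_fun A f \<Longrightarrow> vf X \<Longrightarrow> vf Y \<Longrightarrow>
    nabla X (\<lambda>p. f p *\<^sub>R Y p) = (\<lambda>p. X p f *\<^sub>R Y p + f p *\<^sub>R nabla X Y p)"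
  using levi_civita unfolding levi_civita_def affine_connection_def by blast+

lemma torsion_free: "vf X \<Longrightarrow> vf Y \<Longrightarrow> lie_bracket X Y = nabla X Y - nabla Y X"
  and metric_compatible: "vf X \<Longrightarrow> vf Y \<Longrightarrow> vf Z \<Longrightarrow>
    X p (\<lambda>q. g q (Y q) (Z q)) = g p (nabla X Y p) (Z p) + g p (Y p) (nabla X Z p)"
  using levi_civita unfolding levi_civita_def by (metis, blast)

lemma lie_bracket_field [simp]: "vf X \<Longrightarrow> vf Y \<Longrightarrow> vf (lie_bracket X Y)"
  by (simp add: torsion_free)

lemma nabla_minus_left: "vf X \<Longrightarrow> vf Y \<Longrightarrow> nabla (- X) Y = - nabla X Y"
  using nabla_scale_left[OF smooth_fun_const, of X Y "- 1"] by (simp add: fun_Compl_def)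

lemma nabla_minus_right: "vf X \<Longrightarrow> vf Y \<Longrightarrow> nabla X (- Y) = - nabla X Y"
  using nabla_scale_right[OF smooth_fun_const, of X Y "- 1"]
  by (simp add: fun_Compl_def tangent_const[OF vector_field_at])

lemma nabla_diff_left: "vf X \<Longrightarrow> vf Y \<Longrightarrow> vf Z \<Longrightarrow> nabla (X - Y) Z = nabla X Z - nabla Y Z"
  using nabla_add_left[of X "- Y" Z] by (simp add: nabla_minus_left)

lemma nabla_diff_right: "vf X \<Longrightarrow> vf Y \<Longrightarrow> vf Z \<Longrightarrow> nabla X (Y - Z) = nabla X Y - nabla X Z"
  using nabla_add_right[of X Y "- Z"] by (simp add: nabla_minus_right)

section \<open>Tensoriality and symmetries of the curvature\<close>

lemma curvature_field [simp]: "vf X \<Longrightarrow> vf Y \<Longrightarrow> vf Z \<Longrightarrow> vf (R X Y Z)"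
  by (simp add: curvature_def)

lemma curvature_antisym: "vf X \<Longrightarrow> vf Y \<Longrightarrow> vf Z \<Longrightarrow> R X Y Z = - R Y X Z"
  by (simp add: curvature_def torsion_free nabla_diff_left)

lemma curvature_add1: "vf X \<Longrightarrow> vf X' \<Longrightarrow> vf Y \<Longrightarrow> vf Z \<Longrightarrow> R (X + X') Y Z = R X Y Z + R X' Y Z"
  by (simp add: curvature_def torsion_free nabla_diff_left nabla_add_left nabla_add_right algebra_simps)

lemma curvature_add3: "vf X \<Longrightarrow> vf Y \<Longrightarrow> vf Z \<Longrightarrow> vf Z' \<Longrightarrow> R X Y (Z + Z') = R X Y Z + R X Y Z'"
  by (simp add: curvature_def nabla_add_right algebra_simps)

text \<open>The bracket of \<open>f X\<close> and \<open>Y\<close> is \<open>f\<close> times that of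
  \<open>X\<close> and \<open>Y\<close>, minus \<open>(Y f) X\<close>. The extra term cancels the
  derivative of \<open>f\<close> produced when \<open>nabla Y\<close> acts on \<open>f\<close> times
  \<open>nabla X Z\<close>.\<close>

lemma curvature_scale1:
  assumes f: "smooth_fun A f" and vf: "vf X" "vf Y" "vf Z"
  shows "R (\<lambda>p. f p *\<^sub>R X p) Y Z = (\<lambda>p. f p *\<^sub>R R X Y Z p)"
proof -
  let ?fX = "\<lambda>p. f p *\<^sub>R X p" and ?Yf = "\<lambda>p. Y p f"
  note s = f vector_field_smooth[OF vf(2) f]
  have "lie_bracket ?fX Y = (\<lambda>p. f p *\<^sub>R lie_bracket X Y p) - (\<lambda>p. ?Yf p *\<^sub>R X p)"
    using s vf
    by (simp add: torsion_free nabla_scale_left nabla_scale_right fun_eq_iff algebra_simps)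
  then have "nabla (lie_bracket ?fX Y) Z
      = (\<lambda>p. f p *\<^sub>R nabla (lie_bracket X Y) Z p) - (\<lambda>p. ?Yf p *\<^sub>R nabla X Z p)"
    using s vf by (simp add: nabla_diff_left nabla_scale_left)
  then show ?thesis
    using s vf
    by (simp add: curvature_def nabla_scale_left nabla_scale_right fun_eq_iff algebra_simps)
qed

text \<open>Terms with first derivatives of \<open>f\<close> are symmetric in \<open>X\<close> and
  \<open>Y\<close> and cancel; the second derivatives leave a commutator, which the bracket term
  removes.\<close>

lemma curvature_scale3:
  assumes f: "smooth_fun A f" and vf: "vf X" "vf Y" "vf Z"
  shows "R X Y (\<lambda>p. f p *\<^sub>R Z p) = (\<lambda>p. f p *\<^sub>R R X Y Z p)"
proof -
  have second: "nabla X (nabla Y (\<lambda>p. f p *\<^sub>R Z p)) =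
      (\<lambda>p. X p (\<lambda>q. Y q f) *\<^sub>R Z p) + (\<lambda>p. Y p f *\<^sub>R nabla X Z p)
      + (\<lambda>p. X p f *\<^sub>R nabla Y Z p) + (\<lambda>p. f p *\<^sub>R nabla X (nabla Y Z) p)"
    if v: "vf X" "vf Y" for X Y
  proof -
    have *: "(\<lambda>p. Y p f *\<^sub>R Z p + f p *\<^sub>R nabla Y Z p) = (\<lambda>p. Y p f *\<^sub>R Z p) + (\<lambda>p. f p *\<^sub>R nabla Y Z p)"
      by (simp add: fun_eq_iff)
    show ?thesis
      using f v vf(3) vector_field_smooth[OF v(2) f]
      by (simp add: nabla_scale_right * nabla_add_right) (simp add: fun_eq_iff algebra_simps)
  qed
  have "nabla (lie_bracket X Y) (\<lambda>p. f p *\<^sub>R Z p) =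
      (\<lambda>p. lie_bracket X Y p f *\<^sub>R Z p + f p *\<^sub>R nabla (lie_bracket X Y) Z p)"
    using f vf by (simp add: nabla_scale_right)
  moreover have "lie_bracket X Y p f = X p (\<lambda>q. Y q f) - Y p (\<lambda>q. X q f)" for p
    by (simp add: lie_bracket_def)
  ultimately show ?thesis
    unfolding curvature_def second[OF vf(1,2)] second[OF vf(2,1)]
    by (simp add: fun_eq_iff algebra_simps)
qed

text \<open>Tensoriality handles the first and third slots; the second follows from the first by
  antisymmetry.\<close>

lemma curvature_cong:
  assumes "vf X" "vf Y" "vf Z" "vf X'" "vf Y'" "vf Z'" "X p = X' p" "Y p = Y' p" "Z p = Z' p"
  shows "R X Y Z p = R X' Y' Z' p"
proof -
  have 1: "R X Y Z p = R X' Y Z p" if "vf X" "vf X'" "vf Y" "vf Z" "X p = X' p" for X X' Y Z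
    by (rule tensorial_cong[of "\<lambda>X. R X Y Z p"])
      (use that in \<open>simp_all add: curvature_add1 curvature_scale1\<close>)
  have 3: "R X Y Z p = R X Y Z' p" if "vf X" "vf Y" "vf Z" "vf Z'" "Z p = Z' p" for X Y Z Z'
    by (rule tensorial_cong[of "\<lambda>Z. R X Y Z p"])
      (use that in \<open>simp_all add: curvature_add3 curvature_scale3\<close>)
  have "R X Y Z p = R X' Y Z p" by (rule 1) (use assms in auto)
  also have "\<dots> = - R Y X' Z p" using assms by (simp add: curvature_antisym[of X' Y])
  also have "R Y X' Z p = R Y' X' Z p" by (rule 1) (use assms in auto)
  also have "- R Y' X' Z p = R X' Y' Z p" using assms by (simp add: curvature_antisym[of X' Y'])
  also have "\<dots> = R X' Y' Z' p" by (rule 3) (use assms in auto)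
  finally show ?thesis .
qed

text \<open>The definite description has a value because of \<open>curvature_cong\<close>. Through
  this equation the pointwise hypothesis on sectional curvature becomes one about fields.\<close>

lemma curvature_at_eq:
  assumes "vf X" "vf Y" "vf Z"
  shows "curvature_at A nabla p (X p) (Y p) (Z p) = R X Y Z p"
  unfolding curvature_at_def
proof (rule the_equality)
  show "\<forall>X' Y' Z'. vf X' \<longrightarrow> vf Y' \<longrightarrow> vf Z' \<longrightarrow> X' p = X p \<longrightarrow> Y' p = Y p \<longrightarrow> Z' p = Z p \<longrightarrow>
      R X' Y' Z' p = R X Y Z p"
    using assms curvature_cong by blast
qed (use assms in blast)

text \<open>Absence of torsion turns differences of covariant derivatives into brackets, and the
  Jacobi identity remains.\<close>

lemma Bianchi_identity:
  assumes vf: "vf X" "vf Y" "vf Z"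
  shows "R X Y Z + R Y Z X + R Z X Y = 0"
proof -
  have swap: "nabla X (nabla Y Z) = nabla X (lie_bracket Y Z) + nabla X (nabla Z Y)"
    if "vf X" "vf Y" "vf Z" for X Y Z
    using that by (simp add: torsion_free nabla_diff_right)
  have "R X Y Z + R Y Z X + R Z X Y
      = (nabla X (lie_bracket Y Z) - nabla (lie_bracket Y Z) X)
      + (nabla Y (lie_bracket Z X) - nabla (lie_bracket Z X) Y)
      + (nabla Z (lie_bracket X Y) - nabla (lie_bracket X Y) Z)"
    using swap[OF vf] swap[OF vf(2,3,1)] swap[OF vf(3,1,2)]
    by (simp add: curvature_def algebra_simps)
  also have "\<dots> = lie_bracket X (lie_bracket Y Z) + lie_bracket Y (lie_bracket Z X)
      + lie_bracket Z (lie_bracket X Y)"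
    using vf by (simp add: torsion_free[of _ "lie_bracket _ _"])
  also have "\<dots> = 0" by (rule Jacobi_identity[OF vf])
  finally show ?thesis .
qed

text \<open>The bracket of \<open>X\<close> and \<open>Y\<close> is applied to the function
  \<open>g(Z, W)\<close> in two ways, as a commutator of derivations and by metric compatibility.
  The mixed terms are symmetric in \<open>X\<close> and \<open>Y\<close> and drop out.\<close>

lemma curvature_skew:
  assumes vf: "vf X" "vf Y" "vf Z" "vf W"
  shows "g p (R X Y Z p) (W p) = - g p (Z p) (R X Y W p)"
proof -
  let ?g = "\<lambda>Z W q. g q (Z q) (W q)"
  have second: "X p (\<lambda>q. Y q (?g Z W)) = ?g (nabla X (nabla Y Z)) W p + ?g (nabla Y Z) (nabla X W) p
      + ?g (nabla X Z) (nabla Y W) p + ?g Z (nabla X (nabla Y W)) p"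
    if "vf X" "vf Y" for X Y
    using that vf(3,4)
    by (simp add: metric_compatible tangent_add[OF vector_field_at[OF that(1)]] g_smooth)
  have "lie_bracket X Y p (?g Z W) = X p (\<lambda>q. Y q (?g Z W)) - Y p (\<lambda>q. X q (?g Z W))"
    by (simp add: lie_bracket_def)
  also have "lie_bracket X Y p (?g Z W)
      = ?g (nabla (lie_bracket X Y) Z) W p + ?g Z (nabla (lie_bracket X Y) W) p"
    using vf by (simp add: metric_compatible)
  finally show ?thesis
    unfolding second[OF vf(1,2)] second[OF vf(2,1)]
    using vf by (simp add: curvature_def)
qed

end

section \<open>Quasi-para-Sasakian manifolds\<close>

locale quasi_para_sasakian_manifold =
  fixes A :: "('m::{t2_space, second_countable_topology}, 'e::euclidean_space) atlas"
    and \<phi> :: "'m \<Rightarrow> 'm tvec \<Rightarrow> 'm tvec"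
    and \<eta> :: "'m \<Rightarrow> 'm tvec \<Rightarrow> real"
    and \<xi> :: "'m vfield"
    and g :: "'m \<Rightarrow> 'm tvec \<Rightarrow> 'm tvec \<Rightarrow> real"
    and nabla :: "'m vfield \<Rightarrow> 'm vfield \<Rightarrow> 'm vfield"
  assumes qps: "quasi_para_sasakian A \<phi> \<eta> \<xi> g nabla"

sublocale quasi_para_sasakian_manifold \<subseteq> pseudo_riemannian_manifold A g nabla
  using qps unfolding quasi_para_sasakian_def almost_paracontact_metric_manifold_def
  by unfold_locales auto

context quasi_para_sasakian_manifold
begin

section \<open>Pointwise algebra of the structure tensors\<close>

lemma almost_paracontact: "almost_paracontact_metric_manifold A \<phi> \<eta> \<xi> g"
  using qps unfolding quasi_para_sasakian_def by blast

lemma tensor_\<phi>: "tensor_field_1_1 A \<phi>" and one_form_\<eta>: "one_form A \<eta>"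
  and \<xi>_field [simp]: "vf \<xi>"
  and \<phi>_\<xi> [simp]: "\<phi> p (\<xi> p) = 0" and \<eta>_\<xi> [simp]: "\<eta> p (\<xi> p) = 1"
  and \<eta>_\<phi> [simp]: "x \<in> T p \<Longrightarrow> \<eta> p (\<phi> p x) = 0"
  and \<phi>_\<phi>: "x \<in> T p \<Longrightarrow> \<phi> p (\<phi> p x) = x - \<eta> p x *\<^sub>R \<xi> p"
  and g_\<phi>_\<phi>: "x \<in> T p \<Longrightarrow> y \<in> T p \<Longrightarrow> g p (\<phi> p x) (\<phi> p y) = - g p x y + \<eta> p x * \<eta> p y"
  using almost_paracontact unfolding almost_paracontact_metric_manifold_def by blast+

lemma \<phi>_tangent [simp]: "x \<in> T p \<Longrightarrow> \<phi> p x \<in> T p"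
  and \<phi>_add [simp]: "x \<in> T p \<Longrightarrow> y \<in> T p \<Longrightarrow> \<phi> p (x + y) = \<phi> p x + \<phi> p y"
  and \<phi>_scale [simp]: "x \<in> T p \<Longrightarrow> \<phi> p (c *\<^sub>R x) = c *\<^sub>R \<phi> p x"
  and \<phi>_field: "vf X \<Longrightarrow> vf (\<lambda>p. \<phi> p (X p))"
  using tensor_\<phi> unfolding tensor_field_1_1_def by blast+

lemma \<phi>_minus [simp]: "x \<in> T p \<Longrightarrow> \<phi> p (- x) = - \<phi> p x"
  using \<phi>_scale[of x p "- 1"] by simp

lemma \<phi>_diff [simp]: "x \<in> T p \<Longrightarrow> y \<in> T p \<Longrightarrow> \<phi> p (x - y) = \<phi> p x - \<phi> p y"
  using \<phi>_add[of x p "- y"] by simp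

lemma \<eta>_smooth: "vf X \<Longrightarrow> smooth_fun A (\<lambda>p. \<eta> p (X p))"
  using one_form_\<eta> unfolding one_form_def by blast

lemma \<eta>_eq_g: "x \<in> T p \<Longrightarrow> \<eta> p x = g p x (\<xi> p)"
  using g_\<phi>_\<phi>[of x p "\<xi> p"] by simp

text \<open>Replace \<open>y\<close> by \<open>\<phi> p y\<close> in \<open>g_\<phi>_\<phi>\<close>;
  the \<open>\<xi>\<close> part of the squared \<open>\<phi>\<close> drops out because
  \<open>\<phi> p x\<close> is orthogonal to \<open>\<xi> p\<close>.\<close>

lemma g_\<phi>_skew:
  assumes "x \<in> T p" "y \<in> T p"
  shows "g p (\<phi> p x) y = - g p x (\<phi> p y)"
proof -
  have "g p (\<phi> p x) (\<phi> p (\<phi> p y)) = - g p x (\<phi> p y)"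
    using assms by (simp add: g_\<phi>_\<phi>)
  moreover have "g p (\<phi> p x) (\<xi> p) = 0"
    using assms(1) by (simp add: \<eta>_eq_g[symmetric])
  ultimately show ?thesis
    using assms by (simp add: \<phi>_\<phi>)
qed

definition \<Phi> :: "'m vfield \<Rightarrow> 'm vfield" where
  "\<Phi> X = (\<lambda>p. \<phi> p (X p))"

lemma \<Phi>_apply: "\<Phi> X p = \<phi> p (X p)"
  by (simp add: \<Phi>_def)

lemma \<Phi>_field [simp]: "vf X \<Longrightarrow> vf (\<Phi> X)"
  unfolding \<Phi>_def by (rule \<phi>_field)

section \<open>Covariant derivatives and curvature of the structure\<close>

lemma nabla_\<Phi>:
  "vf X \<Longrightarrow> vf Y \<Longrightarrow> nabla X (\<Phi> Y)
    = \<Phi> (nabla X Y) + (\<lambda>p. g p (X p) (Y p) *\<^sub>R \<xi> p) - (\<lambda>p. \<eta> p (Y p) *\<^sub>R X p)"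
proof
  fix p assume "vf X" "vf Y"
  then have "nabla X (\<Phi> Y) p - \<Phi> (nabla X Y) p = g p (X p) (Y p) *\<^sub>R \<xi> p - \<eta> p (Y p) *\<^sub>R X p"
    using qps unfolding quasi_para_sasakian_def \<Phi>_def by blast
  then show "nabla X (\<Phi> Y) p
      = (\<Phi> (nabla X Y) + (\<lambda>p. g p (X p) (Y p) *\<^sub>R \<xi> p) - (\<lambda>p. \<eta> p (Y p) *\<^sub>R X p)) p"
    by (simp add: algebra_simps)
qed

text \<open>Since \<open>\<xi>\<close> has constant length, \<open>nabla X \<xi>\<close> is
  orthogonal to it. The structure equation for \<open>\<xi>\<close> yields the image of
  \<open>nabla X \<xi>\<close> under \<open>\<phi>\<close>, and applying \<open>\<phi>\<close> once
  more recovers the field itself.\<close>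

lemma nabla_\<xi>:
  assumes "vf X"
  shows "nabla X \<xi> = \<Phi> X"
proof
  fix p
  have X: "X p \<in> T p" and N: "nabla X \<xi> p \<in> T p"
    using assms by simp_all
  have "X p (\<lambda>q. g q (\<xi> q) (\<xi> q)) = 2 * g p (nabla X \<xi> p) (\<xi> p)"
    using assms N by (simp add: metric_compatible g_commute[of "\<xi> p"])
  moreover have "(\<lambda>q. g q (\<xi> q) (\<xi> q)) = (\<lambda>q. 1)"
    by (simp add: \<eta>_eq_g[symmetric])
  ultimately have 0: "\<eta> p (nabla X \<xi> p) = 0"
    using N by (simp add: \<eta>_eq_g tangent_const[OF X])
  have "\<Phi> \<xi> = 0" by (simp add: \<Phi>_def zero_fun_def fun_eq_iff)
  moreover have "nabla X 0 = 0"
    using nabla_add_right[of X 0 0] assms by simp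
  ultimately have "0 = \<phi> p (nabla X \<xi> p) + \<eta> p (X p) *\<^sub>R \<xi> p - X p"
    using fun_cong[OF nabla_\<Phi>[OF assms \<xi>_field], of p] by (simp add: \<Phi>_apply \<eta>_eq_g[OF X])
  then have "\<phi> p (nabla X \<xi> p) = X p - \<eta> p (X p) *\<^sub>R \<xi> p"
    by (simp add: algebra_simps)
  then have "\<phi> p (\<phi> p (nabla X \<xi> p)) = \<phi> p (X p)"
    using X by simp
  then show "nabla X \<xi> p = \<Phi> X p"
    using 0 N by (simp add: \<phi>_\<phi> \<Phi>_apply)
qed

lemma derivative_\<eta>:
  assumes "vf X" "vf Z"
  shows "X p (\<lambda>q. \<eta> q (Z q)) = \<eta> p (nabla X Z p) + g p (Z p) (\<phi> p (X p))"
proof -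
  have "(\<lambda>q. \<eta> q (Z q)) = (\<lambda>q. g q (Z q) (\<xi> q))"
    using assms by (simp add: \<eta>_eq_g)
  then show ?thesis
    using assms by (simp add: metric_compatible nabla_\<xi> \<Phi>_apply \<eta>_eq_g)
qed

text \<open>By \<open>nabla_\<xi>\<close> this is the covariant derivative of \<open>\<phi>\<close>
  antisymmetrised in \<open>X\<close> and \<open>Y\<close>; the terms along \<open>\<xi>\<close>
  cancel as \<open>g\<close> is symmetric.\<close>

lemma curvature_\<xi>:
  assumes "vf X" "vf Y"
  shows "R X Y \<xi> p = \<eta> p (X p) *\<^sub>R Y p - \<eta> p (Y p) *\<^sub>R X p"
  using assms g_commute[of "X p" p "Y p"]
  by (simp add: curvature_def nabla_\<xi> nabla_\<Phi> \<Phi>_apply torsion_free)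

text \<open>The commutator of the curvature with \<open>\<phi>\<close> is the antisymmetrised second
  covariant derivative of \<open>\<phi>\<close>, obtained by differentiating the structure equation
  once more with \<open>nabla_\<xi>\<close> and \<open>derivative_\<eta>\<close>.\<close>

lemma curvature_\<Phi>:
  assumes vf: "vf X" "vf Y" "vf Z"
  shows "R X Y (\<Phi> Z) p = \<phi> p (R X Y Z p)
    + (g p (Z p) (\<phi> p (Y p)) *\<^sub>R X p - g p (Z p) (\<phi> p (X p)) *\<^sub>R Y p
     + g p (Y p) (Z p) *\<^sub>R \<phi> p (X p) - g p (X p) (Z p) *\<^sub>R \<phi> p (Y p))"
proof -
  have second: "nabla X (nabla Y (\<Phi> Z)) p = \<phi> p (nabla X (nabla Y Z) p)
      + g p (X p) (nabla Y Z p) *\<^sub>R \<xi> p - \<eta> p (nabla Y Z p) *\<^sub>R X p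
      + (g p (nabla X Y p) (Z p) + g p (Y p) (nabla X Z p)) *\<^sub>R \<xi> p
      + g p (Y p) (Z p) *\<^sub>R \<phi> p (X p)
      - (\<eta> p (nabla X Z p) + g p (Z p) (\<phi> p (X p))) *\<^sub>R Y p - \<eta> p (Z p) *\<^sub>R nabla X Y p"
    if "vf X" "vf Y" for X Y
    using that vf(3)
    by (simp add: nabla_\<Phi> nabla_add_right nabla_diff_right nabla_scale_right g_smooth \<eta>_smooth
        metric_compatible derivative_\<eta> nabla_\<xi> \<Phi>_apply algebra_simps)
  have "nabla (lie_bracket X Y) (\<Phi> Z) p = \<phi> p (nabla (lie_bracket X Y) Z p)
      + (g p (nabla X Y p) (Z p) - g p (nabla Y X p) (Z p)) *\<^sub>R \<xi> p
      - \<eta> p (Z p) *\<^sub>R (nabla X Y p - nabla Y X p)"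
    using vf by (simp add: nabla_\<Phi> \<Phi>_apply) (simp add: torsion_free)
  then show ?thesis
    using vf g_commute[of "X p" p "nabla Y Z p"] g_commute[of "Y p" p "nabla X Z p"]
    by (simp add: curvature_def second) (simp add: g_commute algebra_simps)
qed

section \<open>The difference from the model tensor of curvature -1\<close>

definition S :: "'m \<Rightarrow> 'm vfield \<Rightarrow> 'm vfield \<Rightarrow> 'm vfield \<Rightarrow> 'm vfield \<Rightarrow> real" where
  "S p X Y Z W = g p (R X Y Z p) (W p)
    + g p (Y p) (Z p) * g p (X p) (W p) - g p (X p) (Z p) * g p (Y p) (W p)"

lemma S_antisym12: "vf X \<Longrightarrow> vf Y \<Longrightarrow> vf Z \<Longrightarrow> vf W \<Longrightarrow> S p X Y Z W = - S p Y X Z W"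
  by (simp add: S_def curvature_antisym[of X Y])

lemma S_antisym34: "vf X \<Longrightarrow> vf Y \<Longrightarrow> vf Z \<Longrightarrow> vf W \<Longrightarrow> S p X Y Z W = - S p X Y W Z"
  by (simp add: S_def curvature_skew[of X Y Z W] g_commute[of "Z p"])

lemma S_Bianchi:
  assumes "vf X" "vf Y" "vf Z" "vf W"
  shows "S p X Y Z W + S p Y Z X W + S p Z X Y W = 0"
proof -
  have "g p ((R X Y Z + R Y Z X + R Z X Y) p) (W p) = 0"
    using assms g_scale_left[of 0 p "W p" 0] by (simp add: Bianchi_identity)
  then show ?thesis
    using assms by (simp add: S_def g_commute[of "X p" p "Y p"] g_commute[of "X p" p "Z p"]
        g_commute[of "Y p" p "Z p"] algebra_simps)
qed

text \<open>The octahedron argument: four Bianchi identities, one for each choice of the last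
  argument, combine with antisymmetry in both pairs.\<close>

lemma S_pair_symmetric:
  assumes "vf X" "vf Y" "vf Z" "vf W"
  shows "S p X Y Z W = S p Z W X Y"
proof -
  note v = assms
  note S_Bianchi[OF v(2,3,1,4), of p] S_Bianchi[OF v(3,1,4,2), of p]
    S_Bianchi[OF v(1,4,2,3), of p] S_Bianchi[OF v(4,2,3,1), of p]
  moreover note S_antisym34[OF v(3,1,2,4), of p] S_antisym34[OF v(4,2,1,3), of p]
    S_antisym34[OF v(2,3,1,4), of p] S_antisym34[OF v(1,4,3,2), of p]
  moreover have "S p Y X W Z = S p X Y Z W" "S p W Z X Y = - S p Z W X Y" "S p Z W Y X = - S p Z W X Y"
    using S_antisym12[OF v(2,1,4,3), of p] S_antisym34[OF v(1,2,4,3), of p]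
      S_antisym12[OF v(4,3,1,2), of p] S_antisym34[OF v(3,4,2,1), of p] by linarith+
  ultimately show ?thesis by linarith
qed

lemma S_add3: "vf X \<Longrightarrow> vf Y \<Longrightarrow> vf Z \<Longrightarrow> vf Z' \<Longrightarrow> vf W \<Longrightarrow>
    S p X Y (Z + Z') W = S p X Y Z W + S p X Y Z' W"
  by (simp add: S_def curvature_add3 algebra_simps)

lemma S_scale3: "smooth_fun A f \<Longrightarrow> vf X \<Longrightarrow> vf Y \<Longrightarrow> vf Z \<Longrightarrow> vf W \<Longrightarrow>
    S p X Y (\<lambda>q. f q *\<^sub>R Z q) W = f p * S p X Y Z W"
  by (simp add: S_def curvature_scale3 algebra_simps)

lemma S_add4: "vf X \<Longrightarrow> vf Y \<Longrightarrow> vf Z \<Longrightarrow> vf W \<Longrightarrow> vf W' \<Longrightarrow>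
    S p X Y Z (W + W') = S p X Y Z W + S p X Y Z W'"
  by (simp add: S_def algebra_simps)

lemma S_scale4: "smooth_fun A f \<Longrightarrow> vf X \<Longrightarrow> vf Y \<Longrightarrow> vf Z \<Longrightarrow> vf W \<Longrightarrow>
    S p X Y Z (\<lambda>q. f q *\<^sub>R W q) = f p * S p X Y Z W"
  by (simp add: S_def algebra_simps)

lemma S_add1: "vf X \<Longrightarrow> vf X' \<Longrightarrow> vf Y \<Longrightarrow> vf Z \<Longrightarrow> vf W \<Longrightarrow>
    S p (X + X') Y Z W = S p X Y Z W + S p X' Y Z W"
  by (simp add: S_pair_symmetric[of _ Y Z W] S_add3)

lemma S_add2: "vf X \<Longrightarrow> vf Y \<Longrightarrow> vf Y' \<Longrightarrow> vf Z \<Longrightarrow> vf W \<Longrightarrow>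
    S p X (Y + Y') Z W = S p X Y Z W + S p X Y' Z W"
  by (simp add: S_pair_symmetric[of X _ Z W] S_add4)

lemma S_scaleR3: "vf X \<Longrightarrow> vf Y \<Longrightarrow> vf Z \<Longrightarrow> vf W \<Longrightarrow> S p X Y (c *\<^sub>R Z) W = c * S p X Y Z W"
  using S_scale3[OF smooth_fun_const] by (simp add: scaleR_fun_def[of c Z])

lemma S_scaleR4: "vf X \<Longrightarrow> vf Y \<Longrightarrow> vf Z \<Longrightarrow> vf W \<Longrightarrow> S p X Y Z (c *\<^sub>R W) = c * S p X Y Z W"
  using S_scale4[OF smooth_fun_const] by (simp add: scaleR_fun_def[of c W])

lemma S_scaleR1: "vf X \<Longrightarrow> vf Y \<Longrightarrow> vf Z \<Longrightarrow> vf W \<Longrightarrow> S p (c *\<^sub>R X) Y Z W = c * S p X Y Z W"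
  by (simp add: S_pair_symmetric[of _ Y Z W] S_scaleR3)

lemma S_scaleR2: "vf X \<Longrightarrow> vf Y \<Longrightarrow> vf Z \<Longrightarrow> vf W \<Longrightarrow> S p X (c *\<^sub>R Y) Z W = c * S p X Y Z W"
  by (simp add: S_pair_symmetric[of X _ Z W] S_scaleR4)

lemma
  assumes "vf X" "vf Y" "vf Z" "vf W"
  shows S_minus1: "S p (- X) Y Z W = - S p X Y Z W"
    and S_minus2: "S p X (- Y) Z W = - S p X Y Z W"
    and S_minus3: "S p X Y (- Z) W = - S p X Y Z W"
    and S_minus4: "S p X Y Z (- W) = - S p X Y Z W"
  using S_scaleR1[OF assms, of p "- 1"] S_scaleR2[OF assms, of p "- 1"]
    S_scaleR3[OF assms, of p "- 1"] S_scaleR4[OF assms, of p "- 1"] by simp_all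

lemmas S_linear = S_minus1 S_minus2 S_minus3 S_minus4 S_add1 S_add2 S_add3 S_add4 S_scaleR1 S_scaleR2 S_scaleR3 S_scaleR4

lemma S_\<xi>: "vf X \<Longrightarrow> vf Y \<Longrightarrow> vf W \<Longrightarrow> S p X Y \<xi> W = 0"
  by (simp add: S_def curvature_\<xi> \<eta>_eq_g)

text \<open>The defect in \<open>curvature_\<Phi>\<close> is shared by the model tensor and cancels
  in the difference; the sign comes from \<open>g_\<phi>_skew\<close>.\<close>

lemma S_\<Phi>:
  assumes "vf X" "vf Y" "vf Z" "vf W"
  shows "S p X Y (\<Phi> Z) W = - S p X Y Z (\<Phi> W)"
  using assms
  by (simp add: S_def curvature_\<Phi> \<Phi>_apply g_\<phi>_skew g_commute[of "Z p"] algebra_simps)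

section \<open>Eigenfields of \<open>\<phi>\<close> and reduction to them\<close>

definition eigenplus :: "'m vfield \<Rightarrow> bool" where "eigenplus X \<longleftrightarrow> vf X \<and> \<Phi> X = X"
definition eigenminus :: "'m vfield \<Rightarrow> bool" where "eigenminus X \<longleftrightarrow> vf X \<and> \<Phi> X = - X"

lemma eigenplus_field [simp]: "eigenplus X \<Longrightarrow> vf X" and eigenminus_field [simp]: "eigenminus X \<Longrightarrow> vf X"
  by (simp_all add: eigenplus_def eigenminus_def)

lemma eigenplus_apply: "eigenplus X \<Longrightarrow> \<phi> p (X p) = X p"
  unfolding eigenplus_def by (metis \<Phi>_apply)

lemma eigenminus_apply: "eigenminus X \<Longrightarrow> \<phi> p (X p) = - X p"
  unfolding eigenminus_def by (metis \<Phi>_apply uminus_apply)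

lemma eigenplus_add: "eigenplus X \<Longrightarrow> eigenplus Y \<Longrightarrow> eigenplus (X + Y)"
  by (auto simp: eigenplus_apply eigenplus_def[of "X + Y"] \<Phi>_def)

lemma eigenminus_add: "eigenminus X \<Longrightarrow> eigenminus Y \<Longrightarrow> eigenminus (X + Y)"
  by (simp add: eigenminus_apply eigenminus_def[of "X + Y"] \<Phi>_apply fun_eq_iff)

lemma eigenminus_scaleR: "eigenminus X \<Longrightarrow> eigenminus (c *\<^sub>R X)"
  by (simp add: eigenminus_apply eigenminus_def[of "c *\<^sub>R X"] \<Phi>_apply fun_eq_iff)

lemma
  shows \<eta>_plus: "eigenplus X \<Longrightarrow> \<eta> p (X p) = 0"
    and \<eta>_minus: "eigenminus X \<Longrightarrow> \<eta> p (X p) = 0"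
proof -
  show "\<eta> p (X p) = 0" if "eigenplus X"
    using \<eta>_\<phi>[of "X p" p] that by (simp add: eigenplus_apply)
  show "\<eta> p (X p) = 0" if "eigenminus X"
    using \<eta>_\<phi>[of "X p" p] that by (simp add: eigenminus_apply \<eta>_eq_g)
qed

text \<open>On \<open>ker \<eta>\<close> the map \<open>\<phi>\<close> reverses the sign of
  \<open>g\<close>, yet here it fixes both arguments.\<close>

lemma g_plus_plus: "eigenplus X \<Longrightarrow> eigenplus Y \<Longrightarrow> g p (X p) (Y p) = 0"
  using g_\<phi>_\<phi>[of "X p" p "Y p"] by (simp add: eigenplus_apply \<eta>_plus)

lemma g_minus_minus: "eigenminus X \<Longrightarrow> eigenminus Y \<Longrightarrow> g p (X p) (Y p) = 0"
  using g_\<phi>_\<phi>[of "X p" p "Y p"] by (simp add: eigenminus_apply \<eta>_minus)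

text \<open>\<open>\<phi>\<close> is an involution on \<open>ker \<eta>\<close>, so half the sum and
  half the difference of \<open>D\<close> and \<open>\<Phi> D\<close> are the spectral parts of the
  projection \<open>D\<close> of \<open>X\<close>. These formulas are global, so the parts are
  smooth fields on the whole manifold.\<close>

lemma field_decomposition:
  assumes "vf X"
  obtains X1 X2 where "eigenplus X1" "eigenminus X2" "X = X1 + X2 + (\<lambda>p. \<eta> p (X p) *\<^sub>R \<xi> p)"
proof
  define D where "D = X - (\<lambda>p. \<eta> p (X p) *\<^sub>R \<xi> p)"
  have D: "vf D"
    using assms by (simp add: D_def \<eta>_smooth)
  have "\<eta> p (D p) = \<eta> p (X p) - \<eta> p (X p) * \<eta> p (\<xi> p)" for p
    using assms by (simp add: D_def \<eta>_eq_g del: \<eta>_\<xi>)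
  with D have *: "\<phi> p (\<phi> p (D p)) = D p" for p
    by (simp add: \<phi>_\<phi>)
  have "\<Phi> ((1/2) *\<^sub>R (D + \<Phi> D)) p = ((1/2) *\<^sub>R (D + \<Phi> D)) p" for p
    using D by (simp add: \<Phi>_apply * add.commute)
  then show "eigenplus ((1/2) *\<^sub>R (D + \<Phi> D))"
    using D unfolding eigenplus_def by (intro conjI ext[of "\<Phi> _"] vector_field_scaleR vector_field_add \<Phi>_field)
  have "\<Phi> ((1/2) *\<^sub>R (D - \<Phi> D)) p = (- ((1/2) *\<^sub>R (D - \<Phi> D))) p" for p
    using D by (simp add: \<Phi>_apply * flip: scaleR_minus_right)
  then show "eigenminus ((1/2) *\<^sub>R (D - \<Phi> D))"
    using D unfolding eigenminus_def by (intro conjI ext[of "\<Phi> _"] vector_field_scaleR vector_field_diff \<Phi>_field)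
  have "(1/2) *\<^sub>R (D + \<Phi> D) + (1/2) *\<^sub>R (D - \<Phi> D) = D"
    by (simp add: algebra_simps flip: scaleR_left_distrib)
  then show "X = (1/2) *\<^sub>R (D + \<Phi> D) + (1/2) *\<^sub>R (D - \<Phi> D) + (\<lambda>p. \<eta> p (X p) *\<^sub>R \<xi> p)"
    by (simp add: D_def)
qed

text \<open>The component along \<open>\<xi>\<close> has a function as coefficient, which is why
  that case covers all multiples \<open>f \<xi>\<close>; with it, additivity of \<open>F\<close> is
  enough.\<close>

lemma additive_vanishes:
  fixes F :: "'m vfield \<Rightarrow> real"
  assumes add: "\<And>X Y. vf X \<Longrightarrow> vf Y \<Longrightarrow> F (X + Y) = F X + F Y"
    and "\<And>X. eigenplus X \<Longrightarrow> F X = 0" "\<And>X. eigenminus X \<Longrightarrow> F X = 0"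
    and "\<And>f. smooth_fun A f \<Longrightarrow> F (\<lambda>q. f q *\<^sub>R \<xi> q) = 0"
    and "vf X"
  shows "F X = 0"
proof (rule field_decomposition[OF \<open>vf X\<close>])
  fix X1 X2 assume *: "eigenplus X1" "eigenminus X2" "X = X1 + X2 + (\<lambda>p. \<eta> p (X p) *\<^sub>R \<xi> p)"
  have s: "smooth_fun A (\<lambda>p. \<eta> p (X p))" by (rule \<eta>_smooth) fact
  have "F X = F (X1 + X2 + (\<lambda>p. \<eta> p (X p) *\<^sub>R \<xi> p))"
    using *(3) by (rule arg_cong)
  also have "\<dots> = 0"
    using *(1,2) s assms(2-4) by (simp add: add)
  finally show "F X = 0" .
qed

text \<open>Moving \<open>\<Phi>\<close> from one slot to the other costs a sign, while equal
  eigenvalues contribute none.\<close>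

lemma
  assumes "vf X" "vf Y"
  shows S_plus_plus: "eigenplus Z \<Longrightarrow> eigenplus W \<Longrightarrow> S p X Y Z W = 0"
    and S_minus_minus: "eigenminus Z \<Longrightarrow> eigenminus W \<Longrightarrow> S p X Y Z W = 0"
proof -
  show "S p X Y Z W = 0" if "eigenplus Z" "eigenplus W"
    using S_\<Phi>[OF assms, of Z W p] that unfolding eigenplus_def by simp
  show "S p X Y Z W = 0" if "eigenminus Z" "eigenminus W"
  proof -
    have "S p X Y (- Z) W = - S p X Y Z (- W)"
      using S_\<Phi>[OF assms, of Z W p] that unfolding eigenminus_def by metis
    then show ?thesis
      using assms that by (simp add: S_linear)
  qed
qed

end

section \<open>Vanishing of the difference tensor when H = -1\<close>

locale quasi_para_sasakian_H_minus_1 = quasi_para_sasakian_manifold +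
  assumes H: "constant_phi_sectional_curvature A \<phi> \<eta> g nabla (- 1)"
begin

text \<open>The curvature term is \<open>1\<close> by hypothesis. The model term is
  \<open>g(\<Phi> X, \<Phi> X) g(X, X) = -1\<close>, because \<open>X\<close> and
  \<open>\<Phi> X\<close> are orthogonal with opposite squared lengths. This is the only place where
  \<open>H\<close> enters.\<close>

lemma S_holomorphic_unit:
  assumes X: "vf X" "\<eta> p (X p) = 0" "g p (X p) (X p) = 1"
  shows "S p X (\<Phi> X) (\<Phi> X) X = 0"
proof -
  have "phi_sectional_curvature A \<phi> g nabla p (X p) = - 1"
    using H X unfolding constant_phi_sectional_curvature_def contact_distribution_def by simp
  then have "g p (R X (\<Phi> X) (\<Phi> X) p) (X p) = 1"
    using curvature_at_eq[of X "\<Phi> X" "\<Phi> X" p] X(1)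
    by (simp add: phi_sectional_curvature_def \<Phi>_apply)
  moreover have "g p (\<phi> p (X p)) (X p) = 0"
    using g_\<phi>_skew[of "X p" p "X p"] g_commute[of "X p" p "\<phi> p (X p)"] X(1) by simp
  ultimately show ?thesis
    using X g_\<phi>_\<phi>[of "X p" p "X p"] by (simp add: S_def \<Phi>_apply)
qed

text \<open>As \<open>a\<close> and \<open>b\<close> are null, rescaling \<open>b\<close> alone turns \<open>a + b\<close> into a unit vector at \<open>p\<close>.\<close>

lemma S_plus_minus_nondegenerate:
  assumes a: "eigenplus a" and b: "eigenminus b" and "g p (a p) (b p) \<noteq> 0"
  shows "S p a b a b = 0"
proof -
  \<comment> \<open>Chosen so that \<open>g(a + k b, a + k b) = 2 k g(a, b) = 1\<close> at
    \<open>p\<close>.\<close>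
  define k where "k = 1 / (2 * g p (a p) (b p))"
  have k: "k \<noteq> 0" "2 * k * g p (a p) (b p) = 1"
    using assms(3) by (simp_all add: k_def)
  define c where "c = k *\<^sub>R b"
  have c: "eigenminus c" unfolding c_def by (rule eigenminus_scaleR[OF b])
  have \<Phi>: "\<Phi> (a + c) = a + - c"
    using a c by (auto simp: \<Phi>_def eigenplus_apply eigenminus_apply)
  have "g p ((a + c) p) ((a + c) p) = 2 * k * g p (a p) (b p)"
    using a b c g_plus_plus[OF a a] g_minus_minus[OF c c] g_commute[of "b p" p "a p"]
    by (simp add: c_def)
  then have "S p (a + c) (\<Phi> (a + c)) (\<Phi> (a + c)) (a + c) = 0"
    using a c by (intro S_holomorphic_unit)
      (simp_all add: k(2) \<eta>_eq_g, simp_all add: \<eta>_eq_g[symmetric] \<eta>_plus \<eta>_minus)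
  \<comment> \<open>By antisymmetry the pair \<open>(a + c, a - c)\<close> counts as
    \<open>-2\<close> times \<open>(a, c)\<close>, and the pair \<open>(a - c, a + c)\<close> as
    \<open>2\<close> times \<open>(a, c)\<close>.\<close>
  moreover have "S p (a + c) (\<Phi> (a + c)) (\<Phi> (a + c)) (a + c) = - 4 * S p a c a c"
  proof -
    have v: "vf a" "vf c" using a c by simp_all
    show ?thesis
      unfolding \<Phi>
      using S_antisym12[of a a a c p] S_antisym12[of c c a c p] S_antisym12[of c a a c p]
        S_antisym34[of a c c a p] S_antisym12[of a a c a p] S_antisym12[of c c c a p]
        S_antisym12[of c a c a p] S_antisym34[of c a c a p]
        S_antisym12[of a a a a p] S_antisym12[of c c a a p] S_antisym12[of a a c c p] S_antisym12[of c c c c p]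
        S_antisym34[of a c a a p] S_antisym34[of c a a a p] S_antisym34[of a c c c p] S_antisym34[of c a c c p] v
      by (simp add: S_linear del: add_uminus_conv_diff)
  qed
  ultimately have "S p a c a c = 0" by simp
  then show ?thesis
    using a b k(1) by (simp add: c_def S_linear)
qed

text \<open>
  When \<open>g(a, b) = 0\<close>, the parallelogram law reduces to \<open>b + c\<close> and \<open>b - c\<close> with \<open>g(a, c) \<noteq> 0\<close>; if there is
  no such \<open>c\<close>, then \<open>a\<close> is orthogonal to the whole tangent space at \<open>p\<close>.
\<close>

lemma S_plus_minus:
  assumes a: "eigenplus a" and b: "eigenminus b"
  shows "S p a b a b = 0"
proof (cases "\<exists>c. eigenminus c \<and> g p (a p) (c p) \<noteq> 0")
  case True
  then obtain c where c: "eigenminus c" "g p (a p) (c p) \<noteq> 0" by blast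
  show ?thesis
  proof (cases "g p (a p) (b p) = 0")
    case True
    define d where "d = - c"
    have d: "eigenminus d" using eigenminus_scaleR[OF c(1), of "- 1"] by (simp add: d_def)
    \<comment> \<open>In the sum of the two expansions the mixed terms cancel, which leaves
      \<open>2 * S p a b a b + 2 * S p a c a c\<close>.\<close>
    have "S p a (b + c) a (b + c) = 0" "S p a (b + d) a (b + d) = 0"
      by (intro S_plus_minus_nondegenerate eigenminus_add a b c d; use True a b c in \<open>simp add: d_def\<close>)+
    moreover have "S p a c a c = 0"
      by (rule S_plus_minus_nondegenerate[OF a c])
    ultimately show ?thesis
      using a b c by (simp add: d_def S_linear del: add_uminus_conv_diff)
  qed (rule S_plus_minus_nondegenerate[OF a b])
next
  case False
  have "g p (a p) y = 0" if "y \<in> T p" for y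
  proof -
    obtain Y where Y: "vf Y" "Y p = y" using vector_field_extension[OF \<open>y \<in> T p\<close>] .
    have "g p (a p) (Y p) = 0"
    proof (rule additive_vanishes[of "\<lambda>Y. g p (a p) (Y p)", OF _ _ _ _ Y(1)])
      show "g p (a p) (X p) = 0" if "eigenplus X" for X using g_plus_plus[OF a that] .
      show "g p (a p) (X p) = 0" if "eigenminus X" for X using False that by blast
      show "g p (a p) (f p *\<^sub>R \<xi> p) = 0" for f
        using a \<eta>_plus[OF a, of p] by (simp add: \<eta>_eq_g)
    qed (use a in simp)
    then show ?thesis using Y(2) by simp
  qed
  \<comment> \<open>After \<open>curvature_skew\<close>, each term of \<open>S p a b a b\<close>
    contains a pairing of \<open>a p\<close> with a tangent vector.\<close>
  then show ?thesis
    using a b by (simp add: S_def curvature_skew[of a b a b])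
qed

text \<open>Polarising in \<open>a\<close> and then in \<open>b\<close> gives
  \<open>S p a b c d = - S p a d c b\<close>. The Bianchi identity, in which
  \<open>S p c a b d\<close> vanishes, and pair symmetry give the same equation without the minus
  sign.\<close>

lemma S_plus_minus_plus_minus:
  assumes ac: "eigenplus a" "eigenplus c" and bd: "eigenminus b" "eigenminus d"
  shows "S p a b c d = 0"
proof -
  have v: "vf a" "vf b" "vf c" "vf d" using ac bd by simp_all
  have polar: "S p a b c b = 0" if "eigenminus b" for b
  proof -
    have "vf b" using that by simp
    have "S p (a + c) b (a + c) b = 0" "S p a b a b = 0" "S p c b c b = 0"
      by (intro S_plus_minus eigenplus_add ac that)+
    then show ?thesis
      using S_pair_symmetric[of a b c b p] v \<open>vf b\<close> by (simp add: S_linear)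
  qed
  have "S p a (b + d) c (b + d) = 0" "S p a b c b = 0" "S p a d c d = 0"
    by (intro polar eigenminus_add bd)+
  then have "S p a b c d + S p a d c b = 0"
    using v by (simp add: S_linear)
  moreover have "S p c a b d = 0"
    using S_pair_symmetric[of c a b d p] S_plus_plus[of b d c a p] ac v by simp
  then have "S p a b c d = S p c b a d"
    using S_Bianchi[of a b c d p] S_antisym12[of b c a d p] v by simp
  ultimately show ?thesis
    using S_pair_symmetric[of c b a d p] v by simp
qed

text \<open>\<open>additive_vanishes\<close> passes from eigenfields to arbitrary fields slot by
  slot: fact \<open>1\<close> frees the last pair behind a mixed first pair, facts \<open>2\<close>
  and \<open>3\<close> then free the first pair, and the last step frees the third slot.\<close>

lemma S_vanishes:
  assumes vf: "vf X" "vf Y" "vf Z" "vf W"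
  shows "S p X Y Z W = 0"
proof -
  have 1: "S p a b Z W = 0" if "eigenplus a" "eigenminus b" "vf Z" "vf W" for a b Z W
  proof (rule additive_vanishes[of "\<lambda>Z. S p a b Z W", OF _ _ _ _ that(3)])
    have v: "vf a" "vf b" using that by simp_all
    show "S p a b (\<lambda>q. f q *\<^sub>R \<xi> q) W = 0" if "smooth_fun A f" for f
      using that v \<open>vf W\<close> by (simp add: S_scale3 S_\<xi>)
    have \<xi>4: "S p a b Z (\<lambda>q. f q *\<^sub>R \<xi> q) = 0" if "smooth_fun A f" "vf Z" for f Z
      using that v S_antisym34[of a b Z \<xi> p] by (simp add: S_scale4 S_\<xi>)
    show "S p a b Z W = 0" if Z: "eigenplus Z" for Z
      by (rule additive_vanishes[of "S p a b Z", OF _ _ _ _ \<open>vf W\<close>])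
        (use v Z \<open>eigenplus a\<close> \<open>eigenminus b\<close> in
          \<open>simp_all add: S_add4 S_plus_plus S_plus_minus_plus_minus \<xi>4\<close>)
    show "S p a b Z W = 0" if Z: "eigenminus Z" for Z
    proof (rule additive_vanishes[of "S p a b Z", OF _ _ _ _ \<open>vf W\<close>])
      show "S p a b Z W = 0" if "eigenplus W" for W
        using S_antisym34[of a b Z W p] S_plus_minus_plus_minus[of a W b Z p] that Z v
          \<open>eigenplus a\<close> \<open>eigenminus b\<close> by simp
    qed (use v Z in \<open>simp_all add: S_add4 S_minus_minus \<xi>4\<close>)
  qed (use that in \<open>simp add: S_add3\<close>)
  \<comment> \<open>Exchanging the pairs lets fact \<open>1\<close> settle a mixed last pair; equal
    types are covered by \<open>S_plus_plus\<close>.\<close>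
  have 2: "S p Z W X Y = 0" if "eigenplus X" "vf Y" "vf Z" "vf W" for X Y Z W
  proof (rule additive_vanishes[of "S p Z W X", OF _ _ _ _ that(2)])
    show "S p Z W X (\<lambda>q. f q *\<^sub>R \<xi> q) = 0" if "smooth_fun A f" for f
      using \<open>eigenplus X\<close> \<open>vf Z\<close> \<open>vf W\<close> that S_antisym34[of Z W X \<xi> p] by (simp add: S_scale4 S_\<xi>)
    show "S p Z W X Y = 0" if "eigenminus Y" for Y
      using 1[of X Y Z W] S_pair_symmetric[of X Y Z W p] that \<open>eigenplus X\<close> \<open>vf Z\<close> \<open>vf W\<close> by simp
  qed (use that in \<open>simp_all add: S_add4 S_plus_plus\<close>)
  have 3: "S p Z W X Y = 0" if "eigenminus X" "vf Y" "vf Z" "vf W" for X Y Z W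
  proof (rule additive_vanishes[of "S p Z W X", OF _ _ _ _ that(2)])
    show "S p Z W X (\<lambda>q. f q *\<^sub>R \<xi> q) = 0" if "smooth_fun A f" for f
      using \<open>eigenminus X\<close> \<open>vf Z\<close> \<open>vf W\<close> that S_antisym34[of Z W X \<xi> p] by (simp add: S_scale4 S_\<xi>)
    show "S p Z W X Y = 0" if "eigenplus Y" for Y
      using 2[of Y X Z W] S_antisym34[of Z W X Y p] that \<open>eigenminus X\<close> \<open>vf Z\<close> \<open>vf W\<close> by simp
  qed (use that in \<open>simp_all add: S_add4 S_minus_minus\<close>)
  show ?thesis
    by (rule additive_vanishes[of "\<lambda>Z. S p X Y Z W", OF _ _ _ _ vf(3)])
      (use vf in \<open>simp_all add: S_add3 2 3 S_scale3 S_\<xi>\<close>)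
qed

theorem constant_curvature_minus_1: "constant_curvature A g nabla (- 1)"
  unfolding constant_curvature_def
proof (intro allI impI ext[of "R _ _ _"])
  fix X Y Z p assume vf: "vf X" "vf Y" "vf Z"
  let ?V = "R X Y Z p + (g p (Y p) (Z p) *\<^sub>R X p - g p (X p) (Z p) *\<^sub>R Y p)"
  \<comment> \<open>By nondegeneracy it suffices to test against each \<open>w\<close>; extending
    \<open>w\<close> to a field makes the inner product a value of \<open>S\<close>.\<close>
  have "?V = 0"
  proof (rule g_nondegenerate)
    fix w assume "w \<in> T p"
    then obtain W where "vf W" "W p = w" by (rule vector_field_extension)
    then show "g p ?V w = 0"
      using S_vanishes[OF vf, of W p] vf by (auto simp: S_def)
  qed (use vf in simp)
  then show "R X Y Z p = - 1 *\<^sub>R (g p (Y p) (Z p) *\<^sub>R X p - g p (X p) (Z p) *\<^sub>R Y p)"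
    by (simp add: add_eq_0_iff2)
qed

end

theorem corollary5p5:
  fixes A :: "('m::{t2_space, second_countable_topology}, 'e::euclidean_space) atlas"
    and \<phi> :: "'m \<Rightarrow> 'm tvec \<Rightarrow> 'm tvec"
    and \<eta> :: "'m \<Rightarrow> 'm tvec \<Rightarrow> real"
    and \<xi> :: "'m vfield"
    and g :: "'m \<Rightarrow> 'm tvec \<Rightarrow> 'm tvec \<Rightarrow> real"
    and nabla :: "'m vfield \<Rightarrow> 'm vfield \<Rightarrow> 'm vfield"
  assumes "quasi_para_sasakian A \<phi> \<eta> \<xi> g nabla"
    and "constant_phi_sectional_curvature A \<phi> \<eta> g nabla (- 1)"
  shows "\<exists>c. constant_curvature A g nabla c"
proof -
  interpret quasi_para_sasakian_H_minus_1 A \<phi> \<eta> \<xi> g nabla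
    by unfold_locales (fact assms)+
  show ?thesis
    using constant_curvature_minus_1 by blast
qed

end
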